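(* Let $\mathrm{Rings}^{ws}$ denote the category of weakly $s$-unital rings and ring homomorphisms. Then the assignment $$\mathrm{SCu}\colon \mathrm{Rings}^{ws}\longrightarrow \mathrm{SCu},\qquad R\mapsto (\Lambda(R),\mathrm{S}(R)),$$ which sends a ring homomorphism $f\colon R\to R'$ to the map $[(x_n)]\mapsto [(f(x_n))]$ (with $f$ applied entrywise), is a functor. In particular, for every weakly $s$-unital ring $R$, the pair $(\Lambda(R),\mathrm{S}(R))$ is an object of the category $\mathrm{SCu}$.
   Context: Rings are associative and not necessarily unital. A ring $R$ is weakly $s$-unital if for every $n\ge1$ and every $a\in M_n(R)$ there are $b,c\in M_n(R)$ with $a=bac$. Matrices. $M_\infty(R)$ is the ring of $\mathbb{N}\times\mathbb{N}$ matrices over $R$ with finitely many nonzero entries; a finite rectangular matrix is identified with its extension by zeros. For finite matrices, $x\oplus y=\begin{pmatrix}x&0\\0&y\end{pmatrix}$. For $a,b\in M_\infty(R)$ write $a\precsim_1 b$ if $a=rbt$ for some $r,t\in M_\infty(R)$. $\Lambda(R)$. Let $T(R)$ be the set of sequences $(a_n)$ in $M_\infty(R)$ with $a_n\precsim_1a_{n+1}$ for all $n$. Write $(a_n)\precsim(b_n)$ if for every $n$ there is $m$ with $a_n\precsim_1b_m$; let $\sim$ be the antisymmetrization, and $\Lambda(R)=T(R)/{\sim}$ with the induced order. Addition: $[(u_n)]+[(u'_n)]=[(u_n\oplus u_n')]$, where the classes are represented by finite matrices $u_n\in M_{k_{n+1}\times k_n}(R)$ (for some positive integers $k_n$) such that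 $u_n=v_{n+1}u_{n+1}z_{n+1}$ for finite matrices $v_{n+1}\in M_{k_{n+1}\times k_{n+2}}(R)$, $z_{n+1}\in M_{k_{n+1}\times k_n}(R)$, and similarly for $(u'_n)$. $\mathrm{S}(R)$ is the submonoid of $\Lambda(R)$ of classes of sequences $(x_n)$ such that for every $n$ there is $y_{n+1}\in M_\infty(R)$ with $y_{n+1}x_{n+1}x_n=x_n$. $\mathrm{Cu}$-semigroups. In a positively ordered monoid $S$, $x\ll y$ means: whenever $(y_n)$ is an increasing sequence with a supremum and $y\le\sup_ny_n$, there is $k$ with $x\le y_k$. $S$ is a $\mathrm{Cu}$-semigroup if: (O1) increasing sequences have suprema; (O2) every $x\in S$ is the supremum of a sequence $(x_n)$ with $x_n\ll x_{n+1}$; (O3) $x'\ll x$ and $y'\ll y$ imply $x'+y'\ll x+y$; (O4) $\sup_n(x_n+y_n)=\sup_nx_n+\sup_ny_n$ for increasing sequences. A $\mathrm{Cu}$-morphism is an ordered monoid morphism preserving $\ll$ and suprema of increasing sequences. The category $\mathrm{SCu}$. A sequence $(x_n)$ in a $\mathrm{Cu}$-semigroup $S$ is weakly increasing if for every $n$ and every $x\ll x_n$ there is $m_0$ such that $x\ll x_m$ for all $m\ge m_0$; such a sequence always has a supremum in $S$. Objects of $\mathrm{SCu}$ are pairs $(S,W)$ with $S$ a $\mathrm{Cu}$-semigroup and $W$ a submonoid of $S$ such that $\sup_nx_n\in W$ for every weakly increasing sequence $(x_n)$ in $S$ whose elements all lie in $W$. Morphisms $(S_1,W_1)\to(S_2,W_2)$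 are $\mathrm{Cu}$-morphisms $f\colon S_1\to S_2$ with $f(W_1)\subseteq W_2$. *)

theory Defs
  imports "HOL-Algebra.Ring" "HOL-Library.FuncSet"
begin

section \<open>Categories and functors\<close>

text \<open>Morphisms are typed by hom-sets, so the same \<open>'m\<close> may be a morphism between several pairs
  of objects; \<open>Comp C A B D g f\<close> is the composite of \<open>f\<close> from \<open>A\<close> to \<open>B\<close> and \<open>g\<close> from \<open>B\<close> to \<open>D\<close>.\<close>

record ('o, 'm) cat =
  Ob :: "'o set"
  Hom :: "'o \<Rightarrow> 'o \<Rightarrow> 'm set"
  Ident :: "'o \<Rightarrow> 'm"
  Comp :: "'o \<Rightarrow> 'o \<Rightarrow> 'o \<Rightarrow> 'm \<Rightarrow> 'm \<Rightarrow> 'm"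

definition is_category :: "('o, 'm) cat \<Rightarrow> bool" where
  "is_category C \<longleftrightarrow>
    (\<forall>A\<in>Ob C. Ident C A \<in> Hom C A A) \<and>
    (\<forall>A\<in>Ob C. \<forall>B\<in>Ob C. \<forall>D\<in>Ob C. \<forall>f\<in>Hom C A B. \<forall>g\<in>Hom C B D.
       Comp C A B D g f \<in> Hom C A D) \<and>
    (\<forall>A\<in>Ob C. \<forall>B\<in>Ob C. \<forall>f\<in>Hom C A B.
       Comp C A A B f (Ident C A) = f \<and> Comp C A B B (Ident C B) f = f) \<and>
    (\<forall>A\<in>Ob C. \<forall>B\<in>Ob C. \<forall>D\<in>Ob C. \<forall>E\<in>Ob C.
       \<forall>f\<in>Hom C A B. \<forall>g\<in>Hom C B D. \<forall>h\<in>Hom C D E.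
       Comp C A D E h (Comp C A B D g f) = Comp C A B E (Comp C B D E h g) f)"

definition is_functor ::
  "('o, 'm) cat \<Rightarrow> ('p, 'n) cat \<Rightarrow> ('o \<Rightarrow> 'p) \<Rightarrow> ('o \<Rightarrow> 'o \<Rightarrow> 'm \<Rightarrow> 'n) \<Rightarrow> bool" where
  "is_functor C D Fo Fm \<longleftrightarrow>
    is_category C \<and> is_category D \<and>
    (\<forall>A\<in>Ob C. Fo A \<in> Ob D) \<and>
    (\<forall>A\<in>Ob C. \<forall>B\<in>Ob C. \<forall>f\<in>Hom C A B. Fm A B f \<in> Hom D (Fo A) (Fo B)) \<and>
    (\<forall>A\<in>Ob C. Fm A A (Ident C A) = Ident D (Fo A)) \<and>
    (\<forall>A\<in>Ob C. \<forall>B\<in>Ob C. \<forall>E\<in>Ob C. \<forall>f\<in>Hom C A B. \<forall>g\<in>Hom C B E.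
       Fm A E (Comp C A B E g f) = Comp D (Fo A) (Fo B) (Fo E) (Fm B E g) (Fm A B f))"


section \<open>Non-unital rings\<close>

text \<open>The library's ring record is reused for its additive theory; its field \<open>one\<close> is
  unconstrained and is never referred to below.\<close>

locale nonunital_ring = abelian_group R for R :: "'a ring" (structure) +
  assumes mult_closed: "\<lbrakk>x \<in> carrier R; y \<in> carrier R\<rbrakk> \<Longrightarrow> x \<otimes> y \<in> carrier R"
    and mult_assoc: "\<lbrakk>x \<in> carrier R; y \<in> carrier R; z \<in> carrier R\<rbrakk>
      \<Longrightarrow> (x \<otimes> y) \<otimes> z = x \<otimes> (y \<otimes> z)"
    and distrib_right: "\<lbrakk>x \<in> carrier R; y \<in> carrier R; z \<in> carrier R\<rbrakk>
      \<Longrightarrow> (x \<oplus> y) \<otimes> z = x \<otimes> z \<oplus> y \<otimes> z"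
    and distrib_left: "\<lbrakk>x \<in> carrier R; y \<in> carrier R; z \<in> carrier R\<rbrakk>
      \<Longrightarrow> z \<otimes> (x \<oplus> y) = z \<otimes> x \<oplus> z \<otimes> y"

definition nonunital_hom :: "'a ring \<Rightarrow> 'b ring \<Rightarrow> ('a \<Rightarrow> 'b) set" where
  "nonunital_hom R R' = hom (add_monoid R) (add_monoid R') \<inter> hom R R'"


section \<open>Matrices\<close>

type_synonym 'a mtx = "nat \<Rightarrow> nat \<Rightarrow> 'a"

definition Minf :: "'a ring \<Rightarrow> 'a mtx set" where
  "Minf R = {a. (\<forall>i j. a i j \<in> carrier R) \<and> finite {(i, j). a i j \<noteq> \<zero>\<^bsub>R\<^esub>}}"

text \<open>Finite rectangular matrices are identified with their extension by zeros; indices start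
  at 0.\<close>

definition Mats :: "'a ring \<Rightarrow> nat \<Rightarrow> nat \<Rightarrow> 'a mtx set" where
  "Mats R k l = {a. (\<forall>i j. a i j \<in> carrier R) \<and> (\<forall>i j. \<not> (i < k \<and> j < l) \<longrightarrow> a i j = \<zero>\<^bsub>R\<^esub>)}"

text \<open>The sum is restricted to the support of a row because \<^const>\<open>finsum\<close> over an infinite
  index set is zero by convention.\<close>

definition mtx_mult :: "'a ring \<Rightarrow> 'a mtx \<Rightarrow> 'a mtx \<Rightarrow> 'a mtx" where
  "mtx_mult R a b = (\<lambda>i j. finsum R (\<lambda>k. a i k \<otimes>\<^bsub>R\<^esub> b k j) {k. a i k \<noteq> \<zero>\<^bsub>R\<^esub>})"

definition weakly_s_unital :: "'a ring \<Rightarrow> bool" where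
  "weakly_s_unital R \<longleftrightarrow>
    (\<forall>n\<ge>1. \<forall>a\<in>Mats R n n. \<exists>b\<in>Mats R n n. \<exists>c\<in>Mats R n n. a = mtx_mult R (mtx_mult R b a) c)"

text \<open>\<open>block_sum R k l x y\<close> is \<open>x \<oplus> y\<close> where \<open>x\<close> is regarded as a \<open>k \<times> l\<close> matrix. The size of \<open>x\<close>
  has to be given, since it cannot be read off from the extension of \<open>x\<close> by zeros.\<close>

definition block_sum :: "'a ring \<Rightarrow> nat \<Rightarrow> nat \<Rightarrow> 'a mtx \<Rightarrow> 'a mtx \<Rightarrow> 'a mtx" where
  "block_sum R k l x y = (\<lambda>i j.
     if i < k \<and> j < l then x i j
     else if k \<le> i \<and> l \<le> j then y (i - k) (j - l)
     else \<zero>\<^bsub>R\<^esub>)"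

definition precsim1 :: "'a ring \<Rightarrow> 'a mtx \<Rightarrow> 'a mtx \<Rightarrow> bool" where
  "precsim1 R a b \<longleftrightarrow> (\<exists>r\<in>Minf R. \<exists>t\<in>Minf R. a = mtx_mult R (mtx_mult R r b) t)"


section \<open>Positively ordered monoids and Cu-semigroups\<close>

text \<open>Monoids are the multiplicatively written ones of the library: in an ordered monoid, \<open>\<otimes>\<close> and
  \<open>\<one>\<close> stand for the addition and the zero element.\<close>

record 'a pom = "'a monoid" +
  pom_le :: "'a \<Rightarrow> 'a \<Rightarrow> bool"  (infixl \<open>\<unlhd>\<index>\<close> 50)

definition order_of :: "'a pom \<Rightarrow> 'a gorder" where
  "order_of S = \<lparr>carrier = carrier S, eq = (=), le = pom_le S\<rparr>"

locale pos_ordered_monoid = comm_monoid S for S :: "'a pom" (structure) +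
  assumes ord: "partial_order (order_of S)"
    and positive: "x \<in> carrier S \<Longrightarrow> \<one> \<unlhd> x"
    and add_mono: "\<lbrakk>x \<in> carrier S; x' \<in> carrier S; y \<in> carrier S; y' \<in> carrier S;
      x \<unlhd> x'; y \<unlhd> y'\<rbrakk> \<Longrightarrow> x \<otimes> y \<unlhd> x' \<otimes> y'"

definition increasing :: "'a pom \<Rightarrow> (nat \<Rightarrow> 'a) \<Rightarrow> bool" where
  "increasing S x \<longleftrightarrow> (\<forall>n. x n \<in> carrier S) \<and> (\<forall>n. x n \<unlhd>\<^bsub>S\<^esub> x (Suc n))"

definition is_seq_sup :: "'a pom \<Rightarrow> (nat \<Rightarrow> 'a) \<Rightarrow> 'a \<Rightarrow> bool" where
  "is_seq_sup S x s \<longleftrightarrow> least (order_of S) s (Upper (order_of S) (range x))"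

definition way_below :: "'a pom \<Rightarrow> 'a \<Rightarrow> 'a \<Rightarrow> bool" where
  "way_below S x y \<longleftrightarrow> x \<in> carrier S \<and> y \<in> carrier S \<and>
    (\<forall>z s. increasing S z \<and> is_seq_sup S z s \<and> y \<unlhd>\<^bsub>S\<^esub> s \<longrightarrow> (\<exists>k. x \<unlhd>\<^bsub>S\<^esub> z k))"

locale Cu_semigroup = pos_ordered_monoid S for S :: "'a pom" (structure) +
  assumes O1: "\<And>x. increasing S x \<Longrightarrow> \<exists>s. is_seq_sup S x s"
    and O2: "\<And>x. x \<in> carrier S \<Longrightarrow> \<exists>u. (\<forall>n. way_below S (u n) (u (Suc n))) \<and> is_seq_sup S u x"
    and O3: "\<And>x x' y y'. \<lbrakk>way_below S x' x; way_below S y' y\<rbrakk> \<Longrightarrow> way_below S (x' \<otimes> y') (x \<otimes> y)"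
    and O4: "\<And>x y s t. \<lbrakk>increasing S x; increasing S y; is_seq_sup S x s; is_seq_sup S y t\<rbrakk>
      \<Longrightarrow> is_seq_sup S (\<lambda>n. x n \<otimes> y n) (s \<otimes> t)"

definition Cu_morphisms :: "'a pom \<Rightarrow> 'b pom \<Rightarrow> ('a \<Rightarrow> 'b) set" where
  "Cu_morphisms S T = {f \<in> hom S T. f \<one>\<^bsub>S\<^esub> = \<one>\<^bsub>T\<^esub> \<and>
    (\<forall>x\<in>carrier S. \<forall>y\<in>carrier S. x \<unlhd>\<^bsub>S\<^esub> y \<longrightarrow> f x \<unlhd>\<^bsub>T\<^esub> f y) \<and>
    (\<forall>x y. way_below S x y \<longrightarrow> way_below T (f x) (f y)) \<and>
    (\<forall>x s. increasing S x \<and> is_seq_sup S x s \<longrightarrow> is_seq_sup T (\<lambda>n. f (x n)) (f s))}"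

definition weakly_increasing :: "'a pom \<Rightarrow> (nat \<Rightarrow> 'a) \<Rightarrow> bool" where
  "weakly_increasing S x \<longleftrightarrow> (\<forall>n. x n \<in> carrier S) \<and>
    (\<forall>n y. way_below S y (x n) \<longrightarrow> (\<exists>m0. \<forall>m\<ge>m0. way_below S y (x m)))"

definition SCu_object :: "'a pom \<times> 'a set \<Rightarrow> bool" where
  "SCu_object = (\<lambda>(S, W). Cu_semigroup S \<and> submonoid W S \<and>
    (\<forall>x. weakly_increasing S x \<and> range x \<subseteq> W \<longrightarrow> (\<exists>s\<in>W. is_seq_sup S x s)))"

definition SCu_morphisms :: "'a pom \<times> 'a set \<Rightarrow> 'b pom \<times> 'b set \<Rightarrow> ('a \<Rightarrow> 'b) set" where
  "SCu_morphisms = (\<lambda>(S, W) (T, V). {f \<in> Cu_morphisms S T. f ` W \<subseteq> V})"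


section \<open>The semigroup \<open>\<Lambda>(R)\<close> and its submonoid \<open>S(R)\<close>\<close>

type_synonym 'a mseq = "nat \<Rightarrow> 'a mtx"

definition Tseqs :: "'a ring \<Rightarrow> 'a mseq set" where
  "Tseqs R = {a. (\<forall>n. a n \<in> Minf R) \<and> (\<forall>n. precsim1 R (a n) (a (Suc n)))}"

definition precsim :: "'a ring \<Rightarrow> 'a mseq \<Rightarrow> 'a mseq \<Rightarrow> bool" where
  "precsim R a b \<longleftrightarrow> (\<forall>n. \<exists>m. precsim1 R (a n) (b m))"

definition Lambda_rel :: "'a ring \<Rightarrow> ('a mseq \<times> 'a mseq) set" where
  "Lambda_rel R = {(a, b). a \<in> Tseqs R \<and> b \<in> Tseqs R \<and> precsim R a b \<and> precsim R b a}"

definition Lambda_class :: "'a ring \<Rightarrow> 'a mseq \<Rightarrow> 'a mseq set" where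
  "Lambda_class R a = Lambda_rel R `` {a}"

definition sized_rep :: "'a ring \<Rightarrow> (nat \<Rightarrow> nat) \<Rightarrow> 'a mseq \<Rightarrow> bool" where
  "sized_rep R k u \<longleftrightarrow> (\<forall>n. 0 < k n) \<and> (\<forall>n. u n \<in> Mats R (k (Suc n)) (k n)) \<and>
    (\<forall>n. \<exists>v\<in>Mats R (k (Suc n)) (k (Suc (Suc n))). \<exists>z\<in>Mats R (k (Suc n)) (k n).
       u n = mtx_mult R (mtx_mult R v (u (Suc n))) z)"

text \<open>Operations given by representatives are formed as the union of the resulting classes over
  all representatives. The resulting sequences lie in \<^term>\<open>Tseqs R\<close>, and distinct classes are
  disjoint and non-empty; so this union is again a class exactly if a representative exists and
  the result does not depend on its choice.\<close>

definition Lambda :: "'a ring \<Rightarrow> 'a mseq set pom" where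
  "Lambda R = \<lparr>carrier = Tseqs R // Lambda_rel R,
     mult = (\<lambda>X Y. \<Union>{Lambda_class R (\<lambda>n. block_sum R (k (Suc n)) (k n) (u n) (u' n)) | k k' u u'.
       u \<in> X \<and> u' \<in> Y \<and> sized_rep R k u \<and> sized_rep R k' u'}),
     one = Lambda_class R (\<lambda>n i j. \<zero>\<^bsub>R\<^esub>),
     pom_le = (\<lambda>X Y. \<exists>a\<in>X. \<exists>b\<in>Y. precsim R a b)\<rparr>"

definition Smon :: "'a ring \<Rightarrow> 'a mseq set set" where
  "Smon R = {Lambda_class R x | x. x \<in> Tseqs R \<and>
     (\<forall>n. \<exists>y\<in>Minf R. mtx_mult R (mtx_mult R y (x (Suc n))) (x n) = x n)}"

definition map_mseq :: "('a \<Rightarrow> 'b) \<Rightarrow> 'a mseq \<Rightarrow> 'b mseq" where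
  "map_mseq f x = (\<lambda>n i j. f (x n i j))"

definition Lambda_map :: "'a ring \<Rightarrow> 'b ring \<Rightarrow> ('a \<Rightarrow> 'b) \<Rightarrow> 'a mseq set \<Rightarrow> 'b mseq set" where
  "Lambda_map R R' f =
    (\<lambda>X\<in>carrier (Lambda R). \<Union>{Lambda_class R' (map_mseq f x) | x. x \<in> X})"


section \<open>The two categories\<close>

text \<open>The underlying sets of the objects are subsets of an arbitrary fixed type, which plays the
  role of the universe. Morphisms are functions on carriers, hence the restriction to extensional
  functions.\<close>

definition Rings_ws :: "('a ring, 'a \<Rightarrow> 'a) cat" where
  "Rings_ws = \<lparr>Ob = {R. nonunital_ring R \<and> weakly_s_unital R},
     Hom = (\<lambda>R R'. nonunital_hom R R' \<inter> extensional (carrier R)),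
     Ident = (\<lambda>R. \<lambda>x\<in>carrier R. x),
     Comp = (\<lambda>R R' R'' g f. compose (carrier R) g f)\<rparr>"

definition SCu_cat :: "('a pom \<times> 'a set, 'a \<Rightarrow> 'a) cat" where
  "SCu_cat = \<lparr>Ob = {P. SCu_object P},
     Hom = (\<lambda>P Q. SCu_morphisms P Q \<inter> extensional (carrier (fst P))),
     Ident = (\<lambda>P. \<lambda>x\<in>carrier (fst P). x),
     Comp = (\<lambda>P Q T g f. compose (carrier (fst P)) g f)\<rparr>"

end

theory Submission
  imports Defs "HOL-Library.Nat_Bijection"
begin

text \<open>\<open>\<Lambda>(R)\<close> is the completion by increasing sequences of the preordered monoid of finite matrices:
  constant sequences are compact, and a class is determined by the ideal of compact elements below
  it. In terms of ideals the order is inclusion, suprema of weakly increasing sequences are unions,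
  and \<open>x \<lless> y\<close> says that \<open>x\<close> lies below a compact element below \<open>y\<close>; the \<open>Cu\<close>-axioms and the properties
  of \<open>Cu\<close>-morphisms follow. Weak \<open>s\<close>-unitality makes \<open>\<precsim>\<^sub>1\<close> reflexive and invariant under
  reindexing of rows and columns, which yields the monoid laws for \<open>\<oplus>\<close> up to equivalence.
  For suprema in \<open>S(R)\<close>, a diagonal sequence \<open>u\<^sub>k\<close> through the representatives satisfies
  \<open>u\<^sub>k = g\<^sub>k u\<^sub>k\<^sub>+\<^sub>1 t\<^sub>k u\<^sub>k\<close>; the equivalent sequence \<open>z\<^sub>k = t\<^sub>k u\<^sub>k\<close> then satisfies
  \<open>z\<^sub>k = (t\<^sub>k g\<^sub>k g\<^sub>k\<^sub>+\<^sub>1 u\<^sub>k\<^sub>+\<^sub>2) z\<^sub>k\<^sub>+\<^sub>1 z\<^sub>k\<close>.\<close>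

section \<open>Completions of preordered monoids\<close>

text \<open>\<open>Upper\<close> tests a bound only against those members of the range that lie in
  the carrier; with all terms in the carrier this becomes an ordinary supremum.\<close>

lemma is_seq_sup_iff:
  assumes "\<And>n. x n \<in> carrier S"
  shows "is_seq_sup S x s \<longleftrightarrow> s \<in> carrier S \<and> (\<forall>n. x n \<unlhd>\<^bsub>S\<^esub> s) \<and>
    (\<forall>t\<in>carrier S. (\<forall>n. x n \<unlhd>\<^bsub>S\<^esub> t) \<longrightarrow> s \<unlhd>\<^bsub>S\<^esub> t)"
  using assms unfolding is_seq_sup_def least_def Upper_def order_of_def by auto

text \<open>Models finite matrices under \<open>precsim1\<close> and block sum, where the monoid
  laws hold only up to equivalence. One direction of associativity is assumed; the other follows
  from commutativity.\<close>

locale preordered_monoid =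
  fixes V :: "'v set" and le :: "'v \<Rightarrow> 'v \<Rightarrow> bool" and plus :: "'v \<Rightarrow> 'v \<Rightarrow> 'v" and zero :: 'v
  assumes refl: "a \<in> V \<Longrightarrow> le a a"
    and trans: "\<lbrakk>le a b; le b c; a \<in> V; b \<in> V; c \<in> V\<rbrakk> \<Longrightarrow> le a c"
    and plus_closed: "\<lbrakk>a \<in> V; b \<in> V\<rbrakk> \<Longrightarrow> plus a b \<in> V"
    and zero_closed: "zero \<in> V"
    and plus_mono: "\<lbrakk>le a a'; le b b'; a \<in> V; a' \<in> V; b \<in> V; b' \<in> V\<rbrakk>
      \<Longrightarrow> le (plus a b) (plus a' b')"
    and plus_comm: "\<lbrakk>a \<in> V; b \<in> V\<rbrakk> \<Longrightarrow> le (plus a b) (plus b a)"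
    and plus_assoc: "\<lbrakk>a \<in> V; b \<in> V; c \<in> V\<rbrakk> \<Longrightarrow> le (plus (plus a b) c) (plus a (plus b c))"
    and zero_le: "a \<in> V \<Longrightarrow> le zero a"
    and plus_zero: "a \<in> V \<Longrightarrow> le (plus a zero) a"
    and le_plus_zero: "a \<in> V \<Longrightarrow> le a (plus a zero)"
begin

section \<open>Increasing sequences and the ideals they generate\<close>

definition chain :: "(nat \<Rightarrow> 'v) \<Rightarrow> bool" where
  "chain a \<longleftrightarrow> (\<forall>n. a n \<in> V \<and> le (a n) (a (Suc n)))"

definition down :: "(nat \<Rightarrow> 'v) \<Rightarrow> 'v set" where
  "down a = {c \<in> V. \<exists>n. le c (a n)}"

lemma chain_in: "chain a \<Longrightarrow> a n \<in> V"
  by (simp add: chain_def)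

lemma chain_mono:
  assumes "chain a" "m \<le> n"
  shows "le (a m) (a n)"
  using assms(2)
proof (induction rule: dec_induct)
  case base
  then show ?case using assms(1) by (simp add: chain_in refl)
next
  case (step n)
  then show ?case using assms(1) trans[of "a m" "a n" "a (Suc n)"] by (auto simp: chain_def)
qed

lemma chain_const: "a \<in> V \<Longrightarrow> chain (\<lambda>_. a)"
  by (simp add: chain_def refl)

lemma down_in: "a \<in> down x \<Longrightarrow> a \<in> V"
  by (simp add: down_def)

lemma chain_in_down: "chain a \<Longrightarrow> a n \<in> down a"
  using chain_in refl by (auto simp: down_def)

lemma down_const: "down (\<lambda>_. a) = {c \<in> V. le c a}"
  by (simp add: down_def)

lemma down_le: "\<lbrakk>chain x; a \<in> down x; le c a; c \<in> V\<rbrakk> \<Longrightarrow> c \<in> down x"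
  unfolding down_def using trans chain_in by blast

lemma down_directed:
  assumes "chain x" "a \<in> down x" "b \<in> down x"
  shows "\<exists>c\<in>down x. le a c \<and> le b c"
proof -
  from assms obtain m n where mn: "le a (x m)" "le b (x n)" and ab: "a \<in> V" "b \<in> V"
    by (auto simp: down_def)
  have "le a (x (max m n))" "le b (x (max m n))"
    using trans[OF mn(1) chain_mono[OF assms(1)]] trans[OF mn(2) chain_mono[OF assms(1)]]
      ab assms(1) chain_in by auto
  then show ?thesis using chain_in_down[OF assms(1)] by blast
qed

lemma zero_plus: "a \<in> V \<Longrightarrow> le (plus zero a) a"
  using plus_comm plus_zero trans plus_closed zero_closed by meson

lemma le_zero_plus: "a \<in> V \<Longrightarrow> le a (plus zero a)"
  using plus_comm le_plus_zero trans plus_closed zero_closed by meson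

text \<open>Commutativity turns \<open>plus a (plus b c)\<close> into
  \<open>plus (plus c b) a\<close>; reassociating and commuting back gives the reverse
  inequality.\<close>

lemma plus_assoc_rev:
  assumes "a \<in> V" "b \<in> V" "c \<in> V"
  shows "le (plus a (plus b c)) (plus (plus a b) c)"
proof -
  have 1: "le (plus a (plus b c)) (plus (plus c b) a)"
    using assms trans[OF plus_comm plus_mono[OF plus_comm refl]] plus_closed by auto
  have 2: "le (plus (plus c b) a) (plus c (plus b a))"
    using assms plus_assoc by auto
  have 3: "le (plus c (plus b a)) (plus (plus a b) c)"
    using assms trans[OF plus_comm plus_mono[OF plus_comm refl]] plus_closed by auto
  show ?thesis
    using trans[OF trans[OF 1 2] 3] assms plus_closed by auto
qed

text \<open>The diagonal leaves each chain one step ahead of where it entered it; the elements of \<open>S(R)\<close>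
  relate consecutive terms only, so their suprema need this extra step.\<close>

lemma cofinal_diagonal:
  fixes x :: "nat \<Rightarrow> nat \<Rightarrow> 'v"
  assumes chain: "\<And>i. chain (x i)"
    and weak: "\<And>i n. \<exists>m0. \<forall>m\<ge>m0. x i n \<in> down (x m)"
  obtains \<iota> \<nu> where "\<And>k. le (x (\<iota> k) (Suc (\<nu> k))) (x (\<iota> (Suc k)) (\<nu> (Suc k)))"
    and "\<And>i n. \<exists>k. le (x i n) (x (\<iota> k) (\<nu> k))"
proof -
  \<comment> \<open>A state is a pair (chain, position). Step \<open>k\<close> must dominate the
    successor of the current entry and also the entry coded by \<open>k\<close>: the first keeps the
    sequence increasing, the second makes it cofinal.\<close>
  define P where "P k s s' \<longleftrightarrow>
      le (x (fst s) (Suc (snd s))) (x (fst s') (snd s')) \<and>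
      le (x (fst (prod_decode k)) (snd (prod_decode k))) (x (fst s') (snd s'))"
    for k :: nat and s s' :: "nat \<times> nat"
  have step: "\<exists>s'. P k s s'" for k s
  proof -
    obtain m0 where m0: "\<And>m. m \<ge> m0 \<Longrightarrow> x (fst s) (Suc (snd s)) \<in> down (x m)"
      using weak by blast
    obtain m1 where m1: "\<And>m. m \<ge> m1 \<Longrightarrow>
        x (fst (prod_decode k)) (snd (prod_decode k)) \<in> down (x m)"
      using weak by blast
    \<comment> \<open>Beyond both thresholds the two elements lie in the same directed ideal, so
      they have a common bound in a single chain.\<close>
    let ?m = "max m0 m1"
    obtain c where "c \<in> down (x ?m)" and c: "le (x (fst s) (Suc (snd s))) c"
        "le (x (fst (prod_decode k)) (snd (prod_decode k))) c"
      using down_directed[OF chain m0 m1, of ?m] by auto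
    then obtain n where n: "le c (x ?m n)" "c \<in> V" by (auto simp: down_def)
    have "P k s (?m, n)"
      unfolding P_def fst_conv snd_conv
      by (intro conjI trans[OF c(1) n(1)] trans[OF c(2) n(1)] n(2) chain_in chain)
    then show ?thesis by blast
  qed
  obtain s where s: "\<And>k. P k (s k) (s (Suc k))"
    using dependent_nat_choice[of "\<lambda>_ _. True" P] step by auto
  show ?thesis
  proof (rule that[of "\<lambda>k. fst (s k)" "\<lambda>k. snd (s k)"])
    show "le (x (fst (s k)) (Suc (snd (s k)))) (x (fst (s (Suc k))) (snd (s (Suc k))))" for k
      using s by (simp add: P_def)
    show "\<exists>k. le (x i n) (x (fst (s k)) (snd (s k)))" for i n
      \<comment> \<open>The entry \<open>(i, n)\<close> is dominated when its code is processed,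
        hence by the state with the next index.\<close>
      using s[of "prod_encode (i, n)"]
      by (intro exI[of _ "Suc (prod_encode (i, n))"]) (simp add: P_def)
  qed
qed

text \<open>Each diagonal entry lies in one of the ideals, and by cofinality every member of any of
  the ideals lies below a diagonal entry.\<close>

lemma cofinal_diagonal_down:
  assumes chain: "\<And>i. chain (x i)"
    and step: "\<And>k. le (x (\<iota> k) (Suc (\<nu> k))) (x (\<iota> (Suc k)) (\<nu> (Suc k)))"
    and cofinal: "\<And>i n. \<exists>k. le (x i n) (x (\<iota> k) (\<nu> k))"
  shows "chain (\<lambda>k. x (\<iota> k) (\<nu> k))"
    and "down (\<lambda>k. x (\<iota> k) (\<nu> k)) = (\<Union>i. down (x i))"
proof -
  have "le (x (\<iota> k) (\<nu> k)) (x (\<iota> (Suc k)) (\<nu> (Suc k)))" for k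
    by (rule trans[OF _ step]) (auto simp: chain_in[OF chain] chain_mono[OF chain])
  then show "chain (\<lambda>k. x (\<iota> k) (\<nu> k))"
    by (simp add: chain_def chain_in[OF chain])
  have "c \<in> down (\<lambda>k. x (\<iota> k) (\<nu> k))" if c: "c \<in> down (x i)" for c i
  proof -
    from c obtain n where n: "le c (x i n)" "c \<in> V" by (auto simp: down_def)
    obtain k where "le (x i n) (x (\<iota> k) (\<nu> k))" using cofinal by blast
    then show ?thesis
      using n trans[OF n(1)] chain_in[OF chain] by (auto simp: down_def)
  qed
  then show "down (\<lambda>k. x (\<iota> k) (\<nu> k)) = (\<Union>i. down (x i))"
    by (auto simp: down_def)
qed

end

text \<open>\<open>S\<close> is the completion of a preordered monoid by increasing sequences: an element \<open>x\<close> is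
  determined by the ideal \<open>D x\<close> of the (compact) monoid elements below it.\<close>

locale sequential_completion = preordered_monoid V le plus zero
  for V :: "'v set" and le plus zero +
  fixes S :: "'s pom" (structure) and D :: "'s \<Rightarrow> 'v set"
  assumes D_eq_down: "x \<in> carrier S \<Longrightarrow> \<exists>a. chain a \<and> D x = down a"
    and ex_down: "chain a \<Longrightarrow> \<exists>x\<in>carrier S. D x = down a"
    and D_inj: "\<lbrakk>x \<in> carrier S; y \<in> carrier S; D x = D y\<rbrakk> \<Longrightarrow> x = y"
    and le_iff: "\<lbrakk>x \<in> carrier S; y \<in> carrier S\<rbrakk> \<Longrightarrow> x \<unlhd> y \<longleftrightarrow> D x \<subseteq> D y"
    and mult_in: "\<lbrakk>x \<in> carrier S; y \<in> carrier S\<rbrakk> \<Longrightarrow> x \<otimes> y \<in> carrier S"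
    and D_mult: "\<lbrakk>x \<in> carrier S; y \<in> carrier S\<rbrakk>
      \<Longrightarrow> D (x \<otimes> y) = {c \<in> V. \<exists>a\<in>D x. \<exists>b\<in>D y. le c (plus a b)}"
    and one_in: "\<one> \<in> carrier S"
    and D_one: "D \<one> = {c \<in> V. le c zero}"
begin

section \<open>Arithmetic and order of ideals\<close>

lemma D_in: "\<lbrakk>x \<in> carrier S; a \<in> D x\<rbrakk> \<Longrightarrow> a \<in> V"
  using D_eq_down down_in by blast

lemma D_le: "\<lbrakk>x \<in> carrier S; a \<in> D x; c \<in> V; le c a\<rbrakk> \<Longrightarrow> c \<in> D x"
  using D_eq_down down_le by metis

lemma D_nonempty: "x \<in> carrier S \<Longrightarrow> D x \<noteq> {}"
  using D_eq_down chain_in_down by blast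

lemma zero_in_D: "x \<in> carrier S \<Longrightarrow> zero \<in> D x"
  using D_nonempty D_le zero_closed zero_le D_in by blast

lemma plus_in_D_mult:
  assumes "x \<in> carrier S" "y \<in> carrier S" "a \<in> D x" "b \<in> D y"
  shows "plus a b \<in> D (x \<otimes> y)"
proof -
  have "plus a b \<in> V" using assms D_in plus_closed by simp
  then show ?thesis using assms(3,4) refl unfolding D_mult[OF assms(1,2)] by blast
qed

text \<open>Since \<open>D z\<close> is closed downwards, it contains the product ideal as soon as
  it contains the sums that generate that ideal.\<close>

lemma D_mult_subset:
  assumes "x \<in> carrier S" "y \<in> carrier S" "z \<in> carrier S"
    and "\<And>a b. \<lbrakk>a \<in> D x; b \<in> D y\<rbrakk> \<Longrightarrow> plus a b \<in> D z"
  shows "D (x \<otimes> y) \<subseteq> D z"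
proof
  fix c assume "c \<in> D (x \<otimes> y)"
  then obtain a b where ab: "a \<in> D x" "b \<in> D y" "c \<in> V" "le c (plus a b)"
    using assms(1,2) by (auto simp: D_mult)
  show "c \<in> D z" by (rule D_le[OF assms(3) assms(4)[OF ab(1,2)] ab(3,4)])
qed

lemma mult_mono:
  assumes "x \<in> carrier S" "y \<in> carrier S" "x' \<in> carrier S" "y' \<in> carrier S"
    and "D x \<subseteq> D x'" "D y \<subseteq> D y'"
  shows "D (x \<otimes> y) \<subseteq> D (x' \<otimes> y')"
  using assms by (intro D_mult_subset plus_in_D_mult mult_in) auto

text \<open>The laws hold in \<open>V\<close> only up to \<open>le\<close>, but \<open>le\<close> in
  both directions gives equal ideals, and \<open>D_inj\<close> turns these into equations in
  \<open>S\<close>.\<close>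

lemma pos_ordered_monoid: "pos_ordered_monoid S"
proof -
  have comm: "D (x \<otimes> y) \<subseteq> D (y \<otimes> x)" if "x \<in> carrier S" "y \<in> carrier S" for x y
    using that
    by (intro D_mult_subset) (auto intro: mult_in D_le[OF _ plus_in_D_mult plus_closed plus_comm] D_in)
  have assoc: "D (x \<otimes> y \<otimes> z) = D (x \<otimes> (y \<otimes> z))"
    if S: "x \<in> carrier S" "y \<in> carrier S" "z \<in> carrier S" for x y z
  proof
    show "D (x \<otimes> y \<otimes> z) \<subseteq> D (x \<otimes> (y \<otimes> z))"
    proof (rule D_mult_subset)
      fix d c assume d: "d \<in> D (x \<otimes> y)" and c: "c \<in> D z"
      then obtain a b where ab: "a \<in> D x" "b \<in> D y" "le d (plus a b)" "d \<in> V"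
        using D_mult S by auto
      have V: "a \<in> V" "b \<in> V" "c \<in> V" using ab c D_in S by auto
      have "le (plus d c) (plus a (plus b c))"
        using trans[OF plus_mono[OF ab(3) refl] plus_assoc] ab V by (simp add: plus_closed)
      then show "plus d c \<in> D (x \<otimes> (y \<otimes> z))"
        using ab c V S by (intro D_le[OF _ plus_in_D_mult[OF _ _ _ plus_in_D_mult]])
          (auto simp: mult_in plus_closed)
    qed (use S mult_in in auto)
    show "D (x \<otimes> (y \<otimes> z)) \<subseteq> D (x \<otimes> y \<otimes> z)"
    proof (rule D_mult_subset)
      fix a d assume a: "a \<in> D x" and d: "d \<in> D (y \<otimes> z)"
      then obtain b c where bc: "b \<in> D y" "c \<in> D z" "le d (plus b c)" "d \<in> V"
        using D_mult S by auto
      have V: "a \<in> V" "b \<in> V" "c \<in> V" using a bc D_in S by auto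
      have "le (plus a d) (plus (plus a b) c)"
        using trans[OF plus_mono[OF refl bc(3)] plus_assoc_rev] bc V by (simp add: plus_closed)
      then show "plus a d \<in> D (x \<otimes> y \<otimes> z)"
        using a bc V S by (intro D_le[OF _ plus_in_D_mult[OF _ _ plus_in_D_mult]])
          (auto simp: mult_in plus_closed)
    qed (use S mult_in in auto)
  qed
  have one: "D (\<one> \<otimes> x) = D x" if S: "x \<in> carrier S" for x
  proof
    show "D (\<one> \<otimes> x) \<subseteq> D x"
    proof (rule D_mult_subset)
      fix a b assume "a \<in> D \<one>" and b: "b \<in> D x"
      then have a: "a \<in> V" "le a zero" using D_one by auto
      have V: "b \<in> V" using b D_in S by auto
      have "le (plus a b) b"
        using trans[OF plus_mono[OF a(2) refl] zero_plus] a V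
        by (simp add: plus_closed zero_closed)
      then show "plus a b \<in> D x" using D_le[OF S b] a V by (simp add: plus_closed)
    qed (use S one_in in auto)
    have "b \<in> D (\<one> \<otimes> x)" if b: "b \<in> D x" for b
    proof -
      have V: "b \<in> V" using b D_in S by auto
      show ?thesis
        using D_le[OF _ plus_in_D_mult[OF one_in S zero_in_D[OF one_in] b]] V S one_in mult_in
          le_zero_plus by blast
    qed
    then show "D x \<subseteq> D (\<one> \<otimes> x)" by blast
  qed
  show ?thesis
  proof (intro pos_ordered_monoid.intro comm_monoidI pos_ordered_monoid_axioms.intro)
    show "partial_order (order_of S)"
      by unfold_locales (auto simp: order_of_def le_iff intro: D_inj)
    show "x \<otimes> y = y \<otimes> x" if "x \<in> carrier S" "y \<in> carrier S" for x y
      using that comm by (intro D_inj mult_in) blast+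
    show "x \<otimes> y \<otimes> z = x \<otimes> (y \<otimes> z)" if "x \<in> carrier S" "y \<in> carrier S" "z \<in> carrier S" for x y z
      using that assoc by (intro D_inj mult_in) auto
    show one_mult: "\<one> \<otimes> x = x" if "x \<in> carrier S" for x
      using that one by (intro D_inj mult_in one_in) auto
    show "\<one> \<unlhd> x" if x: "x \<in> carrier S" for x
    proof -
      have "D \<one> \<subseteq> D x"
        using x D_one zero_in_D D_le by blast
      then show ?thesis using x one_in le_iff by blast
    qed
    show "x \<otimes> y \<unlhd> x' \<otimes> y'"
      if "x \<in> carrier S" "x' \<in> carrier S" "y \<in> carrier S" "y' \<in> carrier S" "x \<unlhd> x'" "y \<unlhd> y'"
      for x x' y y'
      using that mult_mono mult_in le_iff by metis
  qed (auto simp: mult_in one_in)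
qed

section \<open>Suprema as unions of ideals\<close>

lemma is_seq_sup_if_D_eq:
  assumes "\<And>n. x n \<in> carrier S" "s \<in> carrier S" "D s = (\<Union>n. D (x n))"
  shows "is_seq_sup S x s"
  unfolding is_seq_sup_iff[of x S, OF assms(1)] using assms by (auto simp: le_iff)

text \<open>The ideals need not increase; eventual membership of every element still lets one chain
  run diagonally through generating chains, and this chain generates the union.\<close>

lemma D_weak_union:
  fixes x :: "nat \<Rightarrow> 's"
  assumes x: "\<And>n. x n \<in> carrier S"
    and weak: "\<And>i a. a \<in> D (x i) \<Longrightarrow> \<exists>m0. \<forall>m\<ge>m0. a \<in> D (x m)"
  shows "\<exists>s\<in>carrier S. D s = (\<Union>n. D (x n))"
proof -
  obtain a where a: "\<And>i. chain (a i)" "\<And>i. D (x i) = down (a i)"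
    using D_eq_down[OF x] by metis
  have "\<exists>m0. \<forall>m\<ge>m0. a i n \<in> down (a m)" for i n
    using weak[of "a i n" i] a chain_in_down by metis
  then obtain \<iota> \<nu>
    where 1: "\<And>k. le (a (\<iota> k) (Suc (\<nu> k))) (a (\<iota> (Suc k)) (\<nu> (Suc k)))"
      and 2: "\<And>i n. \<exists>k. le (a i n) (a (\<iota> k) (\<nu> k))"
    using cofinal_diagonal[of a] a(1) by blast
  show ?thesis
    using ex_down[OF cofinal_diagonal_down(1)[of a \<iota> \<nu>]]
      cofinal_diagonal_down(2)[of a \<iota> \<nu>] a 1 2 by auto
qed

lemma is_seq_sup_unique:
  assumes "is_seq_sup S x s" "is_seq_sup S x t" "\<And>n. x n \<in> carrier S"
  shows "s = t"
proof -
  have "s \<in> carrier S" "t \<in> carrier S" "s \<unlhd> t" "t \<unlhd> s"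
    using assms is_seq_sup_iff[of x S] by auto
  then show ?thesis using le_iff D_inj by blast
qed

text \<open>The union is the ideal of an element, which is then a supremum; uniqueness of suprema
  gives the converse.\<close>

lemma is_seq_sup_iff_D_weak:
  assumes "\<And>n. x n \<in> carrier S"
    and "\<And>i a. a \<in> D (x i) \<Longrightarrow> \<exists>m0. \<forall>m\<ge>m0. a \<in> D (x m)"
  shows "is_seq_sup S x s \<longleftrightarrow> s \<in> carrier S \<and> D s = (\<Union>n. D (x n))"
proof
  assume s: "is_seq_sup S x s"
  obtain t where t: "t \<in> carrier S" "D t = (\<Union>n. D (x n))" using D_weak_union[of x] assms by blast
  then have "s = t" using is_seq_sup_unique[OF s is_seq_sup_if_D_eq] assms(1) by blast
  then show "s \<in> carrier S \<and> D s = (\<Union>n. D (x n))" using t by simp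
qed (use is_seq_sup_if_D_eq assms(1) in blast)

lemma increasing_D:
  assumes "increasing S x"
  shows "x n \<in> carrier S" "m \<le> n \<Longrightarrow> D (x m) \<subseteq> D (x n)"
proof -
  have S: "x n \<in> carrier S" for n using assms by (simp add: increasing_def)
  then show "x n \<in> carrier S" .
  show "D (x m) \<subseteq> D (x n)" if "m \<le> n"
    by (rule lift_Suc_mono_le[OF _ that, of "\<lambda>n. D (x n)"])
      (use assms S in \<open>auto simp: increasing_def le_iff\<close>)
qed

lemma increasing_iff:
  "increasing S x \<longleftrightarrow> (\<forall>n. x n \<in> carrier S \<and> D (x n) \<subseteq> D (x (Suc n)))"
  using le_iff unfolding increasing_def by metis

lemma increasing_D_weak:
  assumes "increasing S x" "a \<in> D (x i)"
  shows "\<exists>m0. \<forall>m\<ge>m0. a \<in> D (x m)"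
  using assms(2) increasing_D(2)[OF assms(1), of i] by auto

lemma ex_union:
  assumes "increasing S x"
  shows "\<exists>s\<in>carrier S. D s = (\<Union>n. D (x n))"
  by (rule D_weak_union) (use assms increasing_D(1) increasing_D_weak in auto)

lemma is_seq_sup_iff_D:
  assumes "increasing S x"
  shows "is_seq_sup S x s \<longleftrightarrow> s \<in> carrier S \<and> D s = (\<Union>n. D (x n))"
proof (rule is_seq_sup_iff_D_weak)
  show "x n \<in> carrier S" for n using increasing_D(1)[OF assms] .
qed (rule increasing_D_weak[OF assms])

section \<open>Compact elements and the way-below relation\<close>

lemma ex_compact:
  assumes "a \<in> V"
  shows "\<exists>x\<in>carrier S. D x = {c \<in> V. le c a}"
  using ex_down[OF chain_const[OF assms]] by (simp add: down_const)

text \<open>The terms of a chain generating \<open>D x\<close> have principal ideals that increase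
  to \<open>D x\<close>.\<close>

lemma ex_compact_approximation:
  assumes x: "x \<in> carrier S"
  obtains a u where "chain a" "D x = down a" "\<And>n. u n \<in> carrier S"
    "\<And>n. D (u n) = {c \<in> V. le c (a n)}" "increasing S u" "is_seq_sup S u x"
proof -
  obtain a where a: "chain a" "D x = down a" using D_eq_down x by blast
  have "\<forall>n. \<exists>y. y \<in> carrier S \<and> D y = {c \<in> V. le c (a n)}"
    using ex_compact[OF chain_in[OF a(1)]] by blast
  from choice[OF this] obtain u
    where u: "\<And>n. u n \<in> carrier S" "\<And>n. D (u n) = {c \<in> V. le c (a n)}"
    by blast
  have "D (u n) \<subseteq> D (u (Suc n))" for n
    using a(1) u(2) trans unfolding chain_def by blast
  then have "increasing S u" using u(1) by (simp add: increasing_iff)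
  moreover from this have "is_seq_sup S u x"
    using x a(2) u(2) by (auto simp: is_seq_sup_iff_D down_def)
  ultimately show ?thesis using that a u by blast
qed

text \<open>Forwards, the way-below condition is tested on the approximation of \<open>y\<close> by
  compact elements. Backwards, a bound \<open>b\<close> in the ideal of a supremum lies in the ideal
  of one term, which then contains \<open>D x\<close>.\<close>

lemma way_below_iff:
  "way_below S x y \<longleftrightarrow> x \<in> carrier S \<and> y \<in> carrier S \<and> (\<exists>b\<in>D y. \<forall>c\<in>D x. le c b)"
proof
  assume wb: "way_below S x y"
  then have S: "x \<in> carrier S" "y \<in> carrier S" by (auto simp: way_below_def)
  obtain a u where au: "chain a" "D y = down a" "\<And>n. u n \<in> carrier S"
    "\<And>n. D (u n) = {c \<in> V. le c (a n)}" "increasing S u" "is_seq_sup S u y"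
    using ex_compact_approximation S(2) by blast
  moreover have "y \<unlhd> y" using S le_iff by blast
  ultimately obtain k where "x \<unlhd> u k" using wb unfolding way_below_def by blast
  then have "D x \<subseteq> {c \<in> V. le c (a k)}" using le_iff S au by metis
  then show "x \<in> carrier S \<and> y \<in> carrier S \<and> (\<exists>b\<in>D y. \<forall>c\<in>D x. le c b)"
    using S au(1,2) chain_in_down by blast
next
  assume "x \<in> carrier S \<and> y \<in> carrier S \<and> (\<exists>b\<in>D y. \<forall>c\<in>D x. le c b)"
  then obtain b where S: "x \<in> carrier S" "y \<in> carrier S" and b: "b \<in> D y" "\<And>c. c \<in> D x \<Longrightarrow> le c b"
    by blast
  show "way_below S x y"
    unfolding way_below_def
  proof (intro conjI S allI impI)
    fix z s assume zs: "increasing S z \<and> is_seq_sup S z s \<and> y \<unlhd> s"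
    then have "D s = (\<Union>n. D (z n))" "s \<in> carrier S" by (auto simp: is_seq_sup_iff_D)
    moreover have "D y \<subseteq> D s" using zs S le_iff calculation by blast
    ultimately obtain k where k: "b \<in> D (z k)" using b by blast
    have "z k \<in> carrier S" using zs increasing_D by blast
    then show "\<exists>k. x \<unlhd> z k" using k b(2) D_le D_in S le_iff by blast
  qed
qed

text \<open>The defining condition is applied to the compact element generated by \<open>a\<close>,
  which is way below \<open>x i\<close> because \<open>a\<close> lies in
  \<open>D (x i)\<close>.\<close>

lemma weakly_increasing_D:
  assumes x: "weakly_increasing S x" and a: "a \<in> D (x i)"
  shows "\<exists>m0. \<forall>m\<ge>m0. a \<in> D (x m)"
proof -
  have S: "x n \<in> carrier S" for n using x by (simp add: weakly_increasing_def)
  have V: "a \<in> V" using a S D_in by blast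
  obtain u where u: "u \<in> carrier S" "D u = {c \<in> V. le c a}" using ex_compact V by blast
  have "way_below S u (x i)" using u S a by (auto simp: way_below_iff)
  then obtain m0 where m0: "\<And>m. m \<ge> m0 \<Longrightarrow> way_below S u (x m)"
    using x unfolding weakly_increasing_def by blast
  have "a \<in> D (x m)" if m: "m \<ge> m0" for m
  proof -
    obtain b where b: "b \<in> D (x m)" "\<And>c. c \<in> D u \<Longrightarrow> le c b"
      using m0[OF m] by (auto simp: way_below_iff)
    then have "le a b" using u V refl by blast
    then show ?thesis using D_le S b V by blast
  qed
  then show ?thesis by blast
qed

lemma is_seq_sup_iff_D_weakly_increasing:
  assumes "weakly_increasing S x"
  shows "is_seq_sup S x s \<longleftrightarrow> s \<in> carrier S \<and> D s = (\<Union>n. D (x n))"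
proof (rule is_seq_sup_iff_D_weak)
  show "x n \<in> carrier S" for n using assms by (simp add: weakly_increasing_def)
qed (rule weakly_increasing_D[OF assms])

text \<open>All axioms are read off on ideals: suprema are unions, compact approximations give (O2),
  bounds add up for (O3), and (O4) holds because members of two increasing unions occur at a common
  index.\<close>

lemma Cu_semigroup: "Cu_semigroup S"
proof -
  interpret pos_ordered_monoid S by (rule pos_ordered_monoid)
  show ?thesis
  proof unfold_locales
    show "\<exists>s. is_seq_sup S x s" if "increasing S x" for x
      using ex_union[OF that] is_seq_sup_iff_D[OF that] by auto
    show "\<exists>u. (\<forall>n. way_below S (u n) (u (Suc n))) \<and> is_seq_sup S u x" if x: "x \<in> carrier S" for x
    proof -
      obtain a u where au: "chain a" "D x = down a" "\<And>n. u n \<in> carrier S"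
        "\<And>n. D (u n) = {c \<in> V. le c (a n)}" "increasing S u" "is_seq_sup S u x"
        using ex_compact_approximation x by blast
      have "way_below S (u n) (u (Suc n))" for n
        using au(1,3,4) by (auto simp: way_below_iff chain_def)
      then show ?thesis using au by blast
    qed
    show "way_below S (x' \<otimes> y') (x \<otimes> y)" if wb: "way_below S x' x" "way_below S y' y" for x x' y y'
    proof -
      have S: "x \<in> carrier S" "y \<in> carrier S" "x' \<in> carrier S" "y' \<in> carrier S"
        using wb by (auto simp: way_below_iff)
      obtain a b where a: "a \<in> D x" "\<And>c. c \<in> D x' \<Longrightarrow> le c a"
        and b: "b \<in> D y" "\<And>c. c \<in> D y' \<Longrightarrow> le c b"
        using wb unfolding way_below_iff by blast
      have "le c (plus a b)" if c: "c \<in> D (x' \<otimes> y')" for c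
      proof -
        obtain a' b' where ab: "a' \<in> D x'" "b' \<in> D y'" "le c (plus a' b')" "c \<in> V"
          using c D_mult S by auto
        then show ?thesis
          using trans[OF ab(3) plus_mono[OF a(2) b(2)]] a(1) b(1) D_in S plus_closed by auto
      qed
      then show ?thesis
        unfolding way_below_iff using S plus_in_D_mult a(1) b(1) mult_in by blast
    qed
    show "is_seq_sup S (\<lambda>n. x n \<otimes> y n) (s \<otimes> t)"
      if xy: "increasing S x" "increasing S y" and st: "is_seq_sup S x s" "is_seq_sup S y t" for x y s t
    proof -
      note x = increasing_D[OF xy(1)] and y = increasing_D[OF xy(2)]
      have s: "s \<in> carrier S" "D s = (\<Union>n. D (x n))" and t: "t \<in> carrier S" "D t = (\<Union>n. D (y n))"
        using st by (auto simp: is_seq_sup_iff_D xy)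
      have "D (s \<otimes> t) \<subseteq> (\<Union>n. D (x n \<otimes> y n))"
      proof
        fix c assume "c \<in> D (s \<otimes> t)"
        then obtain a b m n where ab: "a \<in> D (x m)" "b \<in> D (y n)" "c \<in> V" "le c (plus a b)"
          using s t D_mult by auto
        have "a \<in> D (x (max m n))" "b \<in> D (y (max m n))"
          using ab x(2)[of m "max m n"] y(2)[of n "max m n"] by auto
        then have "c \<in> D (x (max m n) \<otimes> y (max m n))"
          using ab unfolding D_mult[OF x(1) y(1)] by auto
        then show "c \<in> (\<Union>n. D (x n \<otimes> y n))" by blast
      qed
      moreover have "(\<Union>n. D (x n \<otimes> y n)) \<subseteq> D (s \<otimes> t)"
        using s t x(1) y(1) by (intro UN_least mult_mono) auto
      ultimately show ?thesis
        using s(1) t(1) x(1) y(1) mult_in by (intro is_seq_sup_if_D_eq) auto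
    qed
  qed
qed

end

text \<open>A map of monoids that preserves order, sums and zero up to equivalence extends to
  ideals, sending an ideal to the one generated by its image. Each property of a
  \<open>Cu\<close>-morphism can then be checked on generators.\<close>

lemma Cu_morphismI:
  fixes V leq plus zero S D V' leq' plus' zero' T D' f F
  assumes S: "sequential_completion V leq plus zero S D"
    and T: "sequential_completion V' leq' plus' zero' T D'"
    and f_in: "\<And>a. a \<in> V \<Longrightarrow> f a \<in> V'"
    and f_mono: "\<And>a b. \<lbrakk>a \<in> V; b \<in> V; leq a b\<rbrakk> \<Longrightarrow> leq' (f a) (f b)"
    and f_plus: "\<And>a b. \<lbrakk>a \<in> V; b \<in> V\<rbrakk> \<Longrightarrow> leq' (f (plus a b)) (plus' (f a) (f b))"
      "\<And>a b. \<lbrakk>a \<in> V; b \<in> V\<rbrakk> \<Longrightarrow> leq' (plus' (f a) (f b)) (f (plus a b))"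
    and f_zero: "leq' (f zero) zero'"
    and F_in: "\<And>x. x \<in> carrier S \<Longrightarrow> F x \<in> carrier T"
    and D_F: "\<And>x. x \<in> carrier S \<Longrightarrow> D' (F x) = {c \<in> V'. \<exists>a\<in>D x. leq' c (f a)}"
  shows "F \<in> Cu_morphisms S T"
proof -
  interpret S: sequential_completion V leq plus zero S D by (rule S)
  interpret T: sequential_completion V' leq' plus' zero' T D' by (rule T)
  have f_D: "f a \<in> D' (F x)" if "x \<in> carrier S" "a \<in> D x" for x a
    using that D_F S.D_in f_in T.refl by blast
  have F_sub: "D' (F x) \<subseteq> D' y" if "x \<in> carrier S" "y \<in> carrier T" "\<And>a. a \<in> D x \<Longrightarrow> f a \<in> D' y" for x y
    using that D_F T.D_le by blast
  have mult: "F (x \<otimes>\<^bsub>S\<^esub> y) = F x \<otimes>\<^bsub>T\<^esub> F y" if xy: "x \<in> carrier S" "y \<in> carrier S" for x y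
  proof (rule T.D_inj)
    have "D' (F (x \<otimes>\<^bsub>S\<^esub> y)) \<subseteq> D' (F x \<otimes>\<^bsub>T\<^esub> F y)"
    proof (rule F_sub)
      fix c assume "c \<in> D (x \<otimes>\<^bsub>S\<^esub> y)"
      then obtain a b where ab: "a \<in> D x" "b \<in> D y" "c \<in> V" "leq c (plus a b)"
        using xy S.D_mult by auto
      have V: "a \<in> V" "b \<in> V" using ab xy S.D_in by auto
      have "leq' (f c) (plus' (f a) (f b))"
        using T.trans[OF f_mono f_plus(1)] ab V f_in S.plus_closed T.plus_closed by auto
      moreover have "plus' (f a) (f b) \<in> D' (F x \<otimes>\<^bsub>T\<^esub> F y)"
        using xy ab by (intro T.plus_in_D_mult F_in f_D)
      ultimately show "f c \<in> D' (F x \<otimes>\<^bsub>T\<^esub> F y)"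
        using T.D_le T.mult_in F_in xy f_in ab(3) by metis
    qed (use xy F_in S.mult_in T.mult_in in auto)
    moreover have "D' (F x \<otimes>\<^bsub>T\<^esub> F y) \<subseteq> D' (F (x \<otimes>\<^bsub>S\<^esub> y))"
    proof (rule T.D_mult_subset)
      fix c d assume "c \<in> D' (F x)" "d \<in> D' (F y)"
      then obtain a b where ab: "a \<in> D x" "b \<in> D y" and cd: "c \<in> V'" "d \<in> V'"
        "leq' c (f a)" "leq' d (f b)"
        using xy D_F by auto
      have V: "a \<in> V" "b \<in> V" using ab xy S.D_in by auto
      have "leq' (plus' c d) (f (plus a b))"
        using T.trans[OF T.plus_mono[OF cd(3,4)] f_plus(2)] cd V f_in S.plus_closed T.plus_closed
        by auto
      moreover have "f (plus a b) \<in> D' (F (x \<otimes>\<^bsub>S\<^esub> y))"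
        using xy ab by (intro f_D S.mult_in S.plus_in_D_mult)
      ultimately show "plus' c d \<in> D' (F (x \<otimes>\<^bsub>S\<^esub> y))"
        using T.D_le F_in S.mult_in xy T.plus_closed cd(1,2) by metis
    qed (use xy F_in S.mult_in T.mult_in in auto)
    ultimately show "D' (F (x \<otimes>\<^bsub>S\<^esub> y)) = D' (F x \<otimes>\<^bsub>T\<^esub> F y)" ..
  qed (use xy F_in S.mult_in T.mult_in in auto)
  have one: "F \<one>\<^bsub>S\<^esub> = \<one>\<^bsub>T\<^esub>"
  proof (rule T.D_inj)
    have "f a \<in> D' \<one>\<^bsub>T\<^esub>" if "a \<in> D \<one>\<^bsub>S\<^esub>" for a
      using that S.D_one T.D_one T.trans[OF f_mono f_zero] f_in S.zero_closed T.zero_closed by auto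
    then have "D' (F \<one>\<^bsub>S\<^esub>) \<subseteq> D' \<one>\<^bsub>T\<^esub>" using F_sub S.one_in T.one_in by blast
    moreover have "D' \<one>\<^bsub>T\<^esub> \<subseteq> D' (F \<one>\<^bsub>S\<^esub>)"
      using T.D_one T.zero_in_D T.D_le F_in S.one_in by blast
    ultimately show "D' (F \<one>\<^bsub>S\<^esub>) = D' \<one>\<^bsub>T\<^esub>" ..
  qed (use F_in S.one_in T.one_in in auto)
  have mono: "D' (F x) \<subseteq> D' (F y)" if "x \<in> carrier S" "y \<in> carrier S" "D x \<subseteq> D y" for x y
    using that F_sub F_in f_D by blast
  have wb: "way_below T (F x) (F y)" if wb: "way_below S x y" for x y
  proof -
    obtain b where b: "b \<in> D y" "\<And>c. c \<in> D x \<Longrightarrow> leq c b" and xy: "x \<in> carrier S" "y \<in> carrier S"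
      using wb by (auto simp: S.way_below_iff)
    have "leq' c (f b)" if c: "c \<in> D' (F x)" for c
    proof -
      from c obtain a where a: "a \<in> D x" "leq' c (f a)" "c \<in> V'" using D_F xy by auto
      have V: "a \<in> V" "b \<in> V" using a b xy S.D_in by auto
      show ?thesis using T.trans[OF a(2) f_mono] V a b f_in by auto
    qed
    then show ?thesis using xy F_in f_D b(1) unfolding T.way_below_iff by blast
  qed
  have sup: "is_seq_sup T (\<lambda>n. F (x n)) (F s)" if x: "increasing S x" and s: "is_seq_sup S x s" for x s
  proof (rule T.is_seq_sup_if_D_eq)
    have S: "x n \<in> carrier S" for n using S.increasing_D x by blast
    then show "F (x n) \<in> carrier T" for n using F_in by blast
    have s: "s \<in> carrier S" "D s = (\<Union>n. D (x n))" using s by (auto simp: S.is_seq_sup_iff_D x)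
    then show "F s \<in> carrier T" using F_in by blast
    \<comment> \<open>Forming the ideal generated by the image commutes with unions.\<close>
    show "D' (F s) = (\<Union>n. D' (F (x n)))" using D_F S s by auto
  qed
  show ?thesis
    unfolding Cu_morphisms_def hom_def
    using F_in mult one mono wb sup by (auto simp: S.le_iff T.le_iff)
qed

section \<open>Matrices over non-unital rings\<close>

context nonunital_ring begin

section \<open>Zero products and finite sums in non-unital rings\<close>

lemma zero_mult [simp]: "x \<in> carrier R \<Longrightarrow> \<zero> \<otimes> x = \<zero>"
proof -
  assume x: "x \<in> carrier R"
  have "\<zero> \<otimes> x \<oplus> \<zero> \<otimes> x = \<zero> \<otimes> x"
    using distrib_right[of \<zero> \<zero> x] x by simp
  then show ?thesis using x mult_closed[of \<zero> x] add.l_cancel_one by simp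
qed

lemma mult_zero [simp]: "x \<in> carrier R \<Longrightarrow> x \<otimes> \<zero> = \<zero>"
proof -
  assume x: "x \<in> carrier R"
  have "x \<otimes> \<zero> \<oplus> x \<otimes> \<zero> = x \<otimes> \<zero>"
    using distrib_left[of \<zero> \<zero> x] x by simp
  then show ?thesis using x mult_closed[of x \<zero>] add.l_cancel_one by simp
qed

lemma finsum_mult_right:
  assumes "finite A" "\<And>i. f i \<in> carrier R" "c \<in> carrier R"
  shows "(\<Oplus>i\<in>A. f i) \<otimes> c = (\<Oplus>i\<in>A. f i \<otimes> c)"
  using assms(1) by induction (simp_all add: assms mult_closed distrib_right Pi_def finsum_insert)

lemma finsum_mult_left:
  assumes "finite A" "\<And>i. f i \<in> carrier R" "c \<in> carrier R"
  shows "c \<otimes> (\<Oplus>i\<in>A. f i) = (\<Oplus>i\<in>A. c \<otimes> f i)"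
  using assms(1) by induction (simp_all add: assms mult_closed distrib_left Pi_def finsum_insert)

lemma finsum_swap:
  assumes "finite A" "finite B" "\<And>i j. f i j \<in> carrier R"
  shows "(\<Oplus>i\<in>A. \<Oplus>j\<in>B. f i j) = (\<Oplus>j\<in>B. \<Oplus>i\<in>A. f i j)"
  using assms(1)
proof induction
  case empty then show ?case by simp
next
  case (insert a A)
  then show ?case using assms by (simp add: Pi_def finsum_insert finsum_addf)
qed

section \<open>Matrix products as finite sums\<close>

lemma mtx_mult_eq_finsum:
  assumes a: "a \<in> Minf R" and b: "b \<in> Minf R" and N: "finite N"
    and zero: "\<And>p. p \<notin> N \<Longrightarrow> a i p = \<zero> \<or> b p j = \<zero>"
  shows "mtx_mult R a b i j = (\<Oplus>p\<in>N. a i p \<otimes> b p j)"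
proof -
  let ?A = "{p. a i p \<noteq> \<zero>}"
  have ca: "\<And>i p. a i p \<in> carrier R" and cb: "\<And>p j. b p j \<in> carrier R"
    using a b by (auto simp: Minf_def)
  have "finite (Pair i -` {(i, j). a i j \<noteq> \<zero>})"
    using a by (intro finite_vimageI) (auto simp: Minf_def inj_on_def)
  then have A: "finite ?A" by (simp add: vimage_def)
  \<comment> \<open>The row support used by \<open>mtx_mult\<close> and the set \<open>N\<close> are
    both enlarged to their union; the added products vanish.\<close>
  have "(\<Oplus>p\<in>?A. a i p \<otimes> b p j) = (\<Oplus>p\<in>?A \<union> N. a i p \<otimes> b p j)"
    by (rule add.finprod_mono_neutral_cong_left)
      (use A N ca cb in \<open>auto simp: mult_closed\<close>)
  also have "\<dots> = (\<Oplus>p\<in>N. a i p \<otimes> b p j)"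
    by (rule add.finprod_mono_neutral_cong_right)
      (use A N ca cb zero in \<open>auto simp: mult_closed\<close>, use cb zero in force)
  finally show ?thesis by (simp add: mtx_mult_def)
qed


lemma MatsD: "a \<in> Mats R k l \<Longrightarrow> a i j \<in> carrier R" "\<lbrakk>a \<in> Mats R k l; \<not> (i < k \<and> j < l)\<rbrakk> \<Longrightarrow> a i j = \<zero>"
  by (auto simp: Mats_def)

lemma Mats_mono: "\<lbrakk>k \<le> k'; l \<le> l'\<rbrakk> \<Longrightarrow> Mats R k l \<subseteq> Mats R k' l'"
  using MatsD[of _ k l] by (fastforce simp: Mats_def[of _ k' l'])

lemma Mats_subset_Minf: "Mats R k l \<subseteq> Minf R"
proof
  fix a assume a: "a \<in> Mats R k l"
  then have "{(i, j). a i j \<noteq> \<zero>} \<subseteq> {..<k} \<times> {..<l}" by (auto simp: Mats_def)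
  then have "finite {(i, j). a i j \<noteq> \<zero>}" by (rule finite_subset) simp
  then show "a \<in> Minf R" using a by (auto simp: Minf_def Mats_def)
qed

lemma MinfD: "a \<in> Minf R \<Longrightarrow> a i j \<in> carrier R"
  by (simp add: Minf_def)

text \<open>A threshold rather than a single size, so that finitely many of them can be
  combined.\<close>

lemma Minf_in_Mats:
  assumes "a \<in> Minf R"
  shows "\<exists>n0. \<forall>n\<ge>n0. a \<in> Mats R n n"
proof -
  let ?A = "{(i, j). a i j \<noteq> \<zero>}"
  have A: "finite ?A" using assms by (simp add: Minf_def)
  obtain n0 where n0: "\<And>i. i \<in> fst ` ?A \<union> snd ` ?A \<Longrightarrow> i < n0"
    using A finite_nat_set_iff_bounded[of "fst ` ?A \<union> snd ` ?A"] by auto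
  have bound: "i < n0 \<and> j < n0" if "a i j \<noteq> \<zero>" for i j
  proof -
    have ij: "(i, j) \<in> ?A" using that by simp
    show ?thesis using n0[of i] n0[of j] imageI[OF ij, of fst] imageI[OF ij, of snd] by simp
  qed
  have "a \<in> Mats R n n" if "n \<ge> n0" for n
    using MinfD[OF assms] bound that less_le_trans unfolding Mats_def by blast
  then show ?thesis by blast
qed

text \<open>Inner sizes need not match, since matrices are extended by zeros; the column bound of
  the left factor alone limits the summation.\<close>

lemma mtx_mult_Mats:
  assumes a: "a \<in> Mats R k m" and b: "b \<in> Minf R" "\<And>i j. l \<le> j \<Longrightarrow> b i j = \<zero>"
  shows "mtx_mult R a b \<in> Mats R k l"
    and "mtx_mult R a b i j = (\<Oplus>p\<in>{..<m}. a i p \<otimes> b p j)"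
proof -
  have eq: "mtx_mult R a b i j = (\<Oplus>p\<in>{..<m}. a i p \<otimes> b p j)" for i j
    using a b by (intro mtx_mult_eq_finsum) (auto simp: MatsD Mats_subset_Minf[THEN subsetD])
  then show "mtx_mult R a b i j = (\<Oplus>p\<in>{..<m}. a i p \<otimes> b p j)" .
  show "mtx_mult R a b \<in> Mats R k l"
    using a b unfolding Mats_def eq
    by (auto intro!: finsum_closed add.finprod_one_eqI simp: mult_closed MinfD)
qed

lemma mtx_mult_in_Mats:
  "\<lbrakk>a \<in> Mats R k m; b \<in> Mats R m' l\<rbrakk> \<Longrightarrow> mtx_mult R a b \<in> Mats R k l"
  using Mats_subset_Minf by (intro mtx_mult_Mats(1)) (auto simp: MatsD)

lemma mtx_mult_Mats_eq:
  "\<lbrakk>a \<in> Mats R k m; b \<in> Mats R m' l\<rbrakk> \<Longrightarrow> mtx_mult R a b i j = (\<Oplus>p\<in>{..<m}. a i p \<otimes> b p j)"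
  using Mats_subset_Minf by (intro mtx_mult_Mats(2)[of _ k _ _ l]) (auto simp: MatsD)

text \<open>Brings finitely many matrices into one square size, so that their products become sums
  over a fixed range. Weak \<open>s\<close>-unitality requires this size to be positive.\<close>

lemma common_Mats:
  assumes "finite A" "A \<subseteq> Minf R"
  shows "\<exists>n>0. A \<subseteq> Mats R n n"
proof -
  have "\<forall>a\<in>A. \<exists>n0. \<forall>n\<ge>n0. a \<in> Mats R n n" using Minf_in_Mats assms(2) by blast
  from bchoice[OF this] obtain f where f: "\<forall>a\<in>A. \<forall>n\<ge>f a. a \<in> Mats R n n" by blast
  let ?n = "Suc (Max (f ` A))"
  have "a \<in> Mats R ?n ?n" if "a \<in> A" for a
    using f that assms(1) by (simp add: le_SucI)
  then show ?thesis by (intro exI[of _ ?n]) auto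
qed

lemma mtx_mult_closed:
  assumes "a \<in> Minf R" "b \<in> Minf R"
  shows "mtx_mult R a b \<in> Minf R"
proof -
  obtain n where "a \<in> Mats R n n" "b \<in> Mats R n n" using common_Mats[of "{a, b}"] assms by auto
  then show ?thesis by (rule mtx_mult_in_Mats[THEN subsetD[OF Mats_subset_Minf]])
qed

lemma mtx_mult_assoc:
  assumes "a \<in> Minf R" "b \<in> Minf R" "c \<in> Minf R"
  shows "mtx_mult R (mtx_mult R a b) c = mtx_mult R a (mtx_mult R b c)"
proof -
  obtain n where n: "a \<in> Mats R n n" "b \<in> Mats R n n" "c \<in> Mats R n n"
    using common_Mats[of "{a, b, c}"] assms by auto
  note [simp] = mult_closed MatsD(1)[OF n(1)] MatsD(1)[OF n(2)] MatsD(1)[OF n(3)]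
  show ?thesis
  proof (intro ext)
    fix i j
    have "mtx_mult R (mtx_mult R a b) c i j
        = (\<Oplus>p\<in>{..<n}. (\<Oplus>q\<in>{..<n}. a i q \<otimes> b q p) \<otimes> c p j)"
      using mtx_mult_Mats_eq[OF mtx_mult_in_Mats[OF n(1,2)] n(3)]
      by (simp add: mtx_mult_Mats_eq[OF n(1,2)])
    also have "\<dots> = (\<Oplus>p\<in>{..<n}. \<Oplus>q\<in>{..<n}. a i q \<otimes> b q p \<otimes> c p j)"
      by (simp add: finsum_mult_right)
    also have "\<dots> = (\<Oplus>q\<in>{..<n}. \<Oplus>p\<in>{..<n}. a i q \<otimes> b q p \<otimes> c p j)"
      by (rule finsum_swap) auto
    also have "\<dots> = (\<Oplus>q\<in>{..<n}. a i q \<otimes> (\<Oplus>p\<in>{..<n}. b q p \<otimes> c p j))"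
      by (simp add: finsum_mult_left mult_assoc)
    also have "\<dots> = mtx_mult R a (mtx_mult R b c) i j"
      using mtx_mult_Mats_eq[OF n(1) mtx_mult_in_Mats[OF n(2,3)]]
      by (simp add: mtx_mult_Mats_eq[OF n(2,3)])
    finally show "mtx_mult R (mtx_mult R a b) c i j = mtx_mult R a (mtx_mult R b c) i j" .
  qed
qed

section \<open>Truncation and block sums\<close>

definition mtx_trunc :: "nat \<Rightarrow> nat \<Rightarrow> 'a mtx \<Rightarrow> 'a mtx" where
  "mtx_trunc k l a = (\<lambda>i j. if i < k \<and> j < l then a i j else \<zero>)"

lemma mtx_trunc_in_Mats: "a \<in> Minf R \<Longrightarrow> mtx_trunc k l a \<in> Mats R k l"
  by (auto simp: mtx_trunc_def Mats_def Minf_def)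

lemma mtx_trunc_Mats: "a \<in> Mats R k l \<Longrightarrow> mtx_trunc k l a = a"
  by (intro ext) (auto simp: mtx_trunc_def Mats_def)

text \<open>Cutting the inner index at \<open>m\<close> discards only products with a zero factor,
  so it suffices that one of the two factors vanishes beyond \<open>m\<close>.\<close>

lemma mtx_trunc_mult:
  assumes a: "a \<in> Minf R" and b: "b \<in> Minf R"
    and m: "(\<forall>i p. m \<le> p \<longrightarrow> a i p = \<zero>) \<or> (\<forall>p j. m \<le> p \<longrightarrow> b p j = \<zero>)"
  shows "mtx_mult R (mtx_trunc k m a) (mtx_trunc m l b) = mtx_trunc k l (mtx_mult R a b)"
proof (intro ext)
  fix i j
  have ab: "mtx_mult R a b i j = (\<Oplus>p\<in>{..<m}. a i p \<otimes> b p j)"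
    using a b m by (intro mtx_mult_eq_finsum) auto
  have "mtx_mult R (mtx_trunc k m a) (mtx_trunc m l b) i j
      = (\<Oplus>p\<in>{..<m}. mtx_trunc k m a i p \<otimes> mtx_trunc m l b p j)"
    by (rule mtx_mult_Mats_eq) (auto intro: mtx_trunc_in_Mats a b)
  also have "\<dots> = mtx_trunc k l (mtx_mult R a b) i j"
    using MinfD[OF a] MinfD[OF b]
    by (auto simp: mtx_trunc_def ab mult_closed Pi_def intro!: add.finprod_cong' add.finprod_one_eqI)
  finally show "mtx_mult R (mtx_trunc k m a) (mtx_trunc m l b) i j = mtx_trunc k l (mtx_mult R a b) i j" .
qed

lemma block_sum_in_Mats:
  assumes "a \<in> Minf R" "b \<in> Mats R k' l'"
  shows "block_sum R k l a b \<in> Mats R (k + k') (l + l')"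
  unfolding Mats_def mem_Collect_eq
proof (intro conjI allI impI)
  fix i j
  show "block_sum R k l a b i j \<in> carrier R"
    using MinfD[OF assms(1)] MatsD(1)[OF assms(2)] by (simp add: block_sum_def)
  show "block_sum R k l a b i j = \<zero>" if "\<not> (i < k + k' \<and> j < l + l')"
  proof (cases "k \<le> i \<and> l \<le> j")
    case True
    then have "\<not> (i - k < k' \<and> j - l < l')" using that by linarith
    then show ?thesis using True MatsD(2)[OF assms(2)] by (auto simp: block_sum_def)
  qed (use that in \<open>auto simp: block_sum_def\<close>)
qed

lemma block_sum_closed:
  assumes "a \<in> Minf R" "b \<in> Minf R"
  shows "block_sum R k l a b \<in> Minf R"
proof -
  obtain n where "b \<in> Mats R n n" using common_Mats[of "{b}"] assms by auto
  then show ?thesis using block_sum_in_Mats Mats_subset_Minf assms by blast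
qed

text \<open>The upper left blocks share the inner size \<open>m\<close>, so all cross products
  vanish; the lower right blocks may have any size.\<close>

lemma block_sum_mult:
  assumes a: "a \<in> Mats R k m" "b \<in> Mats R m l" and b: "a' \<in> Minf R" "b' \<in> Minf R"
  shows "mtx_mult R (block_sum R k m a a') (block_sum R m l b b')
    = block_sum R k l (mtx_mult R a b) (mtx_mult R a' b')"
proof (intro ext)
  fix i j
  note Minf = a[THEN Mats_subset_Minf[THEN subsetD]]
  note [simp] = MatsD(1)[OF a(1)] MatsD(1)[OF a(2)] MinfD[OF b(1)] MinfD[OF b(2)] mult_closed
  have eq: "mtx_mult R (block_sum R k m a a') (block_sum R m l b b') i j =
      (\<Oplus>p\<in>N. block_sum R k m a a' i p \<otimes> block_sum R m l b b' p j)"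
    if "finite N" "\<And>p. p \<notin> N \<Longrightarrow> block_sum R k m a a' i p = \<zero> \<or> block_sum R m l b b' p j = \<zero>" for N
    using that by (intro mtx_mult_eq_finsum block_sum_closed Minf b)
  obtain n where n: "a' \<in> Mats R n n" using common_Mats[of "{a'}"] b by auto
  consider "i < k" "j < l" | "k \<le> i" "l \<le> j" | "i < k" "l \<le> j" | "k \<le> i" "j < l"
    by linarith
  then show "mtx_mult R (block_sum R k m a a') (block_sum R m l b b') i j
    = block_sum R k l (mtx_mult R a b) (mtx_mult R a' b') i j"
  proof cases
    case 1
    have "mtx_mult R (block_sum R k m a a') (block_sum R m l b b') i j = (\<Oplus>p\<in>{..<m}. a i p \<otimes> b p j)"
      using 1 by (subst eq[of "{..<m}"]) (auto simp: block_sum_def intro!: add.finprod_cong')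
    then show ?thesis using 1 by (simp add: block_sum_def mtx_mult_Mats_eq[OF a])
  next
    case 2
    \<comment> \<open>Inner indices below \<open>m\<close> meet zeros in row \<open>i\<close>, so
      the sum runs over a copy, shifted by \<open>m\<close>, of the column range of
      \<open>a'\<close>.\<close>
    have "mtx_mult R (block_sum R k m a a') (block_sum R m l b b') i j
        = (\<Oplus>p\<in>(+) m ` {..<n}. a' (i - k) (p - m) \<otimes> b' (p - m) (j - l))"
    proof (subst eq[of "(+) m ` {..<n}"])
      fix p assume p: "p \<notin> (+) m ` {..<n}"
      have "p < m \<or> n \<le> p - m"
      proof (rule ccontr)
        assume "\<not> (p < m \<or> n \<le> p - m)"
        then have "p = m + (p - m)" "p - m \<in> {..<n}" by auto
        then show False using p by blast
      qed
      then show "block_sum R k m a a' i p = \<zero> \<or> block_sum R m l b b' p j = \<zero>"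
        using 2 MatsD(2)[OF n] by (auto simp: block_sum_def)
    qed (use 2 in \<open>auto simp: block_sum_def intro!: add.finprod_cong'\<close>)
    also have "\<dots> = (\<Oplus>p\<in>{..<n}. a' (i - k) p \<otimes> b' p (j - l))"
      by (subst add.finprod_reindex) auto
    also have "\<dots> = mtx_mult R a' b' (i - k) (j - l)"
      by (rule mtx_mult_eq_finsum[symmetric]) (use b MatsD(2)[OF n] in auto)
    finally show ?thesis using 2 by (simp add: block_sum_def)
  next
    case 3
    then show ?thesis by (subst eq[of "{}"]) (auto simp: block_sum_def)
  next
    case 4
    then show ?thesis by (subst eq[of "{}"]) (auto simp: block_sum_def)
  qed
qed

section \<open>The relation \<open>precsim1\<close> and witnesses of prescribed size\<close>

lemma precsim1I: "\<lbrakk>a = mtx_mult R (mtx_mult R r b) t; r \<in> Minf R; t \<in> Minf R\<rbrakk> \<Longrightarrow> precsim1 R a b"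
  by (auto simp: precsim1_def)

lemma precsim1_trans:
  assumes "precsim1 R a b" "precsim1 R b c" and c: "c \<in> Minf R"
  shows "precsim1 R a c"
proof -
  obtain r t where 1: "r \<in> Minf R" "t \<in> Minf R" "a = mtx_mult R (mtx_mult R r b) t"
    using assms by (auto simp: precsim1_def)
  obtain r' t' where 2: "r' \<in> Minf R" "t' \<in> Minf R" "b = mtx_mult R (mtx_mult R r' c) t'"
    using assms by (auto simp: precsim1_def)
  have "a = mtx_mult R (mtx_mult R (mtx_mult R r r') c) (mtx_mult R t' t)"
    using 1 2 c by (simp add: mtx_mult_assoc mtx_mult_closed)
  then show ?thesis using 1(1,2) 2(1,2) precsim1I mtx_mult_closed by blast
qed

text \<open>The rows of \<open>r\<close> and the columns of \<open>t\<close> are cut to the size of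
  \<open>x\<close>, their inner indices to the size of \<open>y\<close>. Neither cut changes the
  product, because \<open>x\<close> and \<open>y\<close> vanish outside their sizes.\<close>

lemma precsim1_Mats:
  assumes x: "x \<in> Mats R k l" and y: "y \<in> Mats R k' l'" and xy: "precsim1 R x y"
  obtains r t where "r \<in> Mats R k k'" "t \<in> Mats R l' l" "x = mtx_mult R (mtx_mult R r y) t"
proof -
  obtain r t where rt: "r \<in> Minf R" "t \<in> Minf R" "x = mtx_mult R (mtx_mult R r y) t"
    using xy by (auto simp: precsim1_def)
  have yM: "y \<in> Minf R" using y Mats_subset_Minf by blast
  obtain n where n: "r \<in> Mats R n n" using common_Mats[of "{r}"] rt by auto
  have ry: "mtx_mult R r y \<in> Mats R n l'" using mtx_mult_in_Mats n y by blast
  have "x = mtx_trunc k l (mtx_mult R (mtx_mult R r y) t)"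
    using mtx_trunc_Mats[OF x] rt(3) by simp
  also have "\<dots> = mtx_mult R (mtx_trunc k l' (mtx_mult R r y)) (mtx_trunc l' l t)"
    using MatsD(2)[OF ry] rt yM by (intro mtx_trunc_mult[symmetric] mtx_mult_closed) auto
  also have "mtx_trunc k l' (mtx_mult R r y) = mtx_mult R (mtx_trunc k k' r) (mtx_trunc k' l' y)"
    using MatsD(2)[OF y] rt yM by (intro mtx_trunc_mult[symmetric]) auto
  finally show ?thesis
    using rt by (intro that[of "mtx_trunc k k' r" "mtx_trunc l' l t"])
      (simp_all add: mtx_trunc_in_Mats mtx_trunc_Mats[OF y])
qed

text \<open>Block sums of the witnesses serve as witnesses; those for the first summand are taken of
  exact size so that the blocks line up.\<close>

lemma block_sum_precsim1:
  assumes a: "a \<in> Mats R k l" "a' \<in> Mats R k' l'" "precsim1 R a a'"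
    and b: "b' \<in> Minf R" "precsim1 R b b'"
  shows "precsim1 R (block_sum R k l a b) (block_sum R k' l' a' b')"
proof -
  obtain r t where 1: "r \<in> Mats R k k'" "t \<in> Mats R l' l" "a = mtx_mult R (mtx_mult R r a') t"
    using precsim1_Mats a by blast
  obtain r' t' where 2: "r' \<in> Minf R" "t' \<in> Minf R" "b = mtx_mult R (mtx_mult R r' b') t'"
    using b by (auto simp: precsim1_def)
  have ra: "mtx_mult R r a' \<in> Mats R k l'" using 1 a mtx_mult_in_Mats by blast
  have "mtx_mult R (mtx_mult R (block_sum R k k' r r') (block_sum R k' l' a' b')) (block_sum R l' l t t')
    = block_sum R k l a b"
    using 1 2 a b ra by (simp add: block_sum_mult mtx_mult_closed)
  then show ?thesis
    using 1 2 Mats_subset_Minf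
    by (intro precsim1I[of _ "block_sum R k k' r r'" _ "block_sum R l' l t t'"] block_sum_closed) auto
qed

end

section \<open>The semigroup of a weakly \<open>s\<close>-unital ring\<close>

locale ws_unital_ring = nonunital_ring +
  assumes weakly_s_unital: "weakly_s_unital R"
begin

section \<open>Reflexivity and reindexing from weak \<open>s\<close>-unitality\<close>

lemma precsim1_refl:
  assumes "a \<in> Minf R"
  shows "precsim1 R a a"
proof -
  obtain n where n: "a \<in> Mats R n n" "n > 0" using common_Mats[of "{a}"] assms by auto
  then obtain b c where "b \<in> Mats R n n" "c \<in> Mats R n n" "a = mtx_mult R (mtx_mult R b a) c"
    using weakly_s_unital unfolding weakly_s_unital_def by (metis Suc_leI One_nat_def)
  then show ?thesis using Mats_subset_Minf precsim1I by blast
qed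

text \<open>Local units from weak \<open>s\<close>-unitality take the place of the permutation matrices, which need
  not exist over \<open>R\<close>.\<close>

lemma precsim1_reindex:
  assumes a: "a \<in> Mats R k l" and b: "b \<in> Minf R"
    and eq: "\<And>i j. i < k \<Longrightarrow> j < l \<Longrightarrow> a i j = b (\<sigma> i) (\<tau> j)"
  shows "precsim1 R a b"
proof -
  obtain r t where rt: "r \<in> Minf R" "t \<in> Minf R" "b = mtx_mult R (mtx_mult R r b) t"
    using precsim1_refl[OF b] by (auto simp: precsim1_def)
  obtain n where n: "r \<in> Mats R n n" "b \<in> Mats R n n" "t \<in> Mats R n n"
    using common_Mats[of "{r, b, t}"] rt b by auto
  \<comment> \<open>Rows of \<open>r\<close> and columns of \<open>t\<close> are copied along
    \<open>\<sigma>\<close> and \<open>\<tau>\<close>, so inside the size of \<open>a\<close> the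
    entry of \<open>r' b t'\<close> at \<open>(i, j)\<close> is that of \<open>r b t = b\<close> at
    \<open>(\<sigma> i, \<tau> j)\<close>.\<close>
  define r' where "r' = (\<lambda>i p. if i < k then r (\<sigma> i) p else \<zero>)"
  define t' where "t' = (\<lambda>p j. if j < l then t p (\<tau> j) else \<zero>)"
  have r': "r' \<in> Mats R k n" and t': "t' \<in> Mats R n l"
    using n by (auto simp: r'_def t'_def Mats_def)
  have rb: "mtx_mult R r b \<in> Mats R n n" and rb': "mtx_mult R r' b \<in> Mats R k n"
    using mtx_mult_in_Mats n r' by blast+
  have "a i j = mtx_mult R (mtx_mult R r' b) t' i j" for i j
  proof (cases "i < k \<and> j < l")
    case True
    have "a i j = mtx_mult R (mtx_mult R r b) t (\<sigma> i) (\<tau> j)"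
      using eq True rt(3) by simp
    also have "\<dots> = (\<Oplus>p\<in>{..<n}. (\<Oplus>q\<in>{..<n}. r (\<sigma> i) q \<otimes> b q p) \<otimes> t p (\<tau> j))"
      by (simp add: mtx_mult_Mats_eq[OF rb n(3)] mtx_mult_Mats_eq[OF n(1,2)])
    also have "\<dots> = mtx_mult R (mtx_mult R r' b) t' i j"
    proof -
      have "r' i q = r (\<sigma> i) q" "t' p j = t p (\<tau> j)" for p q
        using True by (simp_all add: r'_def t'_def)
      then show ?thesis by (simp add: mtx_mult_Mats_eq[OF rb' t'] mtx_mult_Mats_eq[OF r' n(2)])
    qed
    finally show ?thesis .
  next
    case False
    then show ?thesis using MatsD(2)[OF a] MatsD(2)[OF mtx_mult_in_Mats[OF rb' t']] by simp
  qed
  then show ?thesis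
    using r' t' by (intro precsim1I[of _ r' _ t'] ext subsetD[OF Mats_subset_Minf])
qed

section \<open>The preordered monoid of finite matrices\<close>

definition msize :: "'a mtx \<Rightarrow> nat" where
  "msize a = (LEAST n. 0 < n \<and> a \<in> Mats R n n)"

text \<open>A block sum depends on the size assigned to its first summand; fixing that size turns it
  into a binary operation.\<close>

definition mplus :: "'a mtx \<Rightarrow> 'a mtx \<Rightarrow> 'a mtx" where
  "mplus a b = block_sum R (msize a) (msize a) a b"

lemma msize: "a \<in> Minf R \<Longrightarrow> a \<in> Mats R (msize a) (msize a)"
  using common_Mats[of "{a}"] LeastI_ex[of "\<lambda>n. 0 < n \<and> a \<in> Mats R n n"] by (auto simp: msize_def)

text \<open>Every admissible size of \<open>a\<close> gives an equivalent sum: reflexivity for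
  \<open>a\<close> provides witnesses between the two sizes.\<close>

lemma block_sum_precsim1_mplus:
  assumes "a \<in> Mats R k l" "b \<in> Minf R"
  shows "precsim1 R (block_sum R k l a b) (mplus a b)" "precsim1 R (mplus a b) (block_sum R k l a b)"
proof -
  have "a \<in> Minf R" using assms Mats_subset_Minf by blast
  then show "precsim1 R (block_sum R k l a b) (mplus a b)" "precsim1 R (mplus a b) (block_sum R k l a b)"
    unfolding mplus_def using assms by (auto intro!: block_sum_precsim1 precsim1_refl msize)
qed

lemma zero_in_Mats: "(\<lambda>i j. \<zero>) \<in> Mats R k l"
  by (simp add: Mats_def)

lemma mplus_comm:
  assumes "a \<in> Minf R" "b \<in> Minf R"
  shows "precsim1 R (mplus a b) (mplus b a)"
proof -
  let ?n = "msize a" and ?m = "msize b"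
  \<comment> \<open>Swaps the two index blocks; it serves for rows and columns alike.\<close>
  let ?\<sigma> = "\<lambda>i. if i < ?n then ?m + i else i - ?n"
  show ?thesis
    unfolding mplus_def
  proof (rule precsim1_reindex)
    show "block_sum R ?n ?n a b \<in> Mats R (?n + ?m) (?n + ?m)" "block_sum R ?m ?m b a \<in> Minf R"
      using assms by (auto intro: block_sum_in_Mats block_sum_closed msize)
    show "block_sum R ?n ?n a b i j = block_sum R ?m ?m b a (?\<sigma> i) (?\<sigma> j)"
      if "i < ?n + ?m" "j < ?n + ?m" for i j
      using that by (auto simp: block_sum_def)
  qed
qed

lemma block_sum_assoc:
  "block_sum R (k + k') (l + l') (block_sum R k l a b) c = block_sum R k l a (block_sum R k' l' b c)"
  by (intro ext) (auto simp: block_sum_def)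

text \<open>Block sums with fixed sizes are strictly associative. Only the sizes differ:
  \<open>msize (mplus a b)\<close> may be smaller than the sum of the two sizes, which costs an
  equivalence.\<close>

lemma mplus_assoc:
  assumes "a \<in> Minf R" "b \<in> Minf R" "c \<in> Minf R"
  shows "precsim1 R (mplus (mplus a b) c) (mplus a (mplus b c))"
proof -
  let ?n = "msize a" and ?m = "msize b"
  have "mplus a b \<in> Mats R (?n + ?m) (?n + ?m)"
    unfolding mplus_def using assms by (intro block_sum_in_Mats msize)
  then have "precsim1 R (mplus (mplus a b) c) (block_sum R (?n + ?m) (?n + ?m) (mplus a b) c)"
    using assms block_sum_precsim1_mplus(2) by blast
  also have "block_sum R (?n + ?m) (?n + ?m) (mplus a b) c = mplus a (mplus b c)"
    unfolding mplus_def by (rule block_sum_assoc)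
  finally show ?thesis .
qed


lemma mplus_zero: "a \<in> Minf R \<Longrightarrow> mplus a (\<lambda>i j. \<zero>) = a"
  using MatsD(2)[OF msize] by (intro ext) (auto simp: mplus_def block_sum_def)

lemma mplus_closed: "\<lbrakk>a \<in> Minf R; b \<in> Minf R\<rbrakk> \<Longrightarrow> mplus a b \<in> Minf R"
  by (simp add: mplus_def block_sum_closed)

lemma zero_in_Minf: "(\<lambda>i j. \<zero>) \<in> Minf R"
  using zero_in_Mats Mats_subset_Minf by blast

sublocale M: preordered_monoid "Minf R" "precsim1 R" mplus "\<lambda>i j. \<zero>"
proof
  show "precsim1 R (mplus a b) (mplus a' b')"
    if "precsim1 R a a'" "precsim1 R b b'" "a \<in> Minf R" "a' \<in> Minf R" "b' \<in> Minf R" for a a' b b'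
    unfolding mplus_def using that by (intro block_sum_precsim1 msize)
  show "precsim1 R (\<lambda>i j. \<zero>) a" if "a \<in> Minf R" for a
    \<comment> \<open>The zero matrix is read as a \<open>0\<close> by \<open>0\<close> matrix, so
      the reindexing condition is vacuous.\<close>
    using that zero_in_Mats by (intro precsim1_reindex[of _ 0 0]) auto
qed (auto simp: precsim1_refl mplus_closed zero_in_Minf mplus_comm mplus_assoc mplus_zero
    intro: precsim1_trans)

section \<open>\<open>\<Lambda>(R)\<close> as a sequential completion\<close>

lemma chain_iff: "M.chain a \<longleftrightarrow> a \<in> Tseqs R"
  by (auto simp: M.chain_def Tseqs_def)

text \<open>By reflexivity the terms of \<open>a\<close> lie in the ideal of \<open>a\<close>, so
  inclusion of ideals amounts to domination term by term.\<close>

lemma precsim_iff: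
  assumes "a \<in> Tseqs R" "b \<in> Tseqs R"
  shows "precsim R a b \<longleftrightarrow> M.down a \<subseteq> M.down b"
proof
  show "M.down a \<subseteq> M.down b" if ab: "precsim R a b"
  proof
    fix c assume "c \<in> M.down a"
    then obtain n where n: "c \<in> Minf R" "precsim1 R c (a n)" by (auto simp: M.down_def)
    obtain m where "precsim1 R (a n) (b m)" using ab by (auto simp: precsim_def)
    then have "precsim1 R c (b m)"
      using precsim1_trans[OF n(2)] M.chain_in[of b] assms(2) chain_iff by blast
    then show "c \<in> M.down b" using n(1) by (auto simp: M.down_def)
  qed
  show "precsim R a b" if sub: "M.down a \<subseteq> M.down b"
    unfolding precsim_def
  proof
    fix n
    have "a n \<in> M.down b" using sub M.chain_in_down[of a n] assms(1) chain_iff by blast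
    then show "\<exists>m. precsim1 R (a n) (b m)" by (auto simp: M.down_def)
  qed
qed

lemma Lambda_class_eq: "a \<in> Tseqs R \<Longrightarrow> Lambda_class R a = {b \<in> Tseqs R. M.down b = M.down a}"
  by (auto simp: Lambda_class_def Lambda_rel_def precsim_iff)

lemma Lambda_class_eq_iff:
  "\<lbrakk>a \<in> Tseqs R; b \<in> Tseqs R\<rbrakk> \<Longrightarrow> Lambda_class R a = Lambda_class R b \<longleftrightarrow> M.down a = M.down b"
  by (auto simp: Lambda_class_eq)

lemma carrier_Lambda: "carrier (Lambda R) = Lambda_class R ` Tseqs R"
  by (auto simp: Lambda_def quotient_def Lambda_class_def)

text \<open>Collecting the matrices below terms of any representative avoids a choice; all
  representatives of a class give the same ideal.\<close>

definition compacts :: "'a mseq set \<Rightarrow> 'a mtx set" where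
  "compacts X = {c \<in> Minf R. \<exists>b\<in>X. \<exists>n. precsim1 R c (b n)}"

lemma compacts_class: "a \<in> Tseqs R \<Longrightarrow> compacts (Lambda_class R a) = M.down a"
  by (auto simp: compacts_def Lambda_class_eq M.down_def)

lemma ex_sized_rep:
  assumes "u \<in> Tseqs R"
  shows "\<exists>k. sized_rep R k u"
proof -
  have u: "u n \<in> Minf R" "precsim1 R (u n) (u (Suc n))" for n using assms by (auto simp: Tseqs_def)
  have "\<forall>n. \<exists>N. \<forall>m\<ge>N. u n \<in> Mats R m m" using Minf_in_Mats[OF u(1)] by blast
  from choice[OF this] obtain N where N: "\<And>n m. N n \<le> m \<Longrightarrow> u n \<in> Mats R m m"
    by blast
  \<comment> \<open>Partial sums dominate \<open>N\<close> and increase, so the square size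
    \<open>k n\<close> can be padded to \<open>k (Suc n)\<close> rows; the \<open>Suc\<close> keeps
    the sizes positive.\<close>
  define k where "k n = Suc (\<Sum>i\<le>n. N i)" for n
  have "N n \<le> k n" for n
    unfolding k_def by (intro le_SucI member_le_sum) auto
  then have "u n \<in> Mats R (k n) (k n)" for n using N by blast
  moreover have "k n \<le> k (Suc n)" for n by (simp add: k_def)
  ultimately have k: "u n \<in> Mats R (k (Suc n)) (k n)" for n
    using Mats_mono[of "k n" "k (Suc n)" "k n" "k n"] by blast
  have "\<exists>v\<in>Mats R (k (Suc n)) (k (Suc (Suc n))). \<exists>z\<in>Mats R (k (Suc n)) (k n).
       u n = mtx_mult R (mtx_mult R v (u (Suc n))) z" for n
    by (rule precsim1_Mats[OF k k u(2), of n]) blast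
  moreover have "0 < k n" for n by (simp add: k_def)
  ultimately show ?thesis using k unfolding sized_rep_def by blast
qed

lemma sized_rep_Mats: "sized_rep R k u \<Longrightarrow> u n \<in> Mats R (k (Suc n)) (k n)"
  by (simp add: sized_rep_def)

definition block_seq :: "(nat \<Rightarrow> nat) \<Rightarrow> 'a mseq \<Rightarrow> 'a mseq \<Rightarrow> 'a mseq" where
  "block_seq k u u' = (\<lambda>n. block_sum R (k (Suc n)) (k n) (u n) (u' n))"

lemma block_seq_Tseqs:
  assumes "sized_rep R k u" "u \<in> Tseqs R" "u' \<in> Tseqs R"
  shows "block_seq k u u' \<in> Tseqs R"
  using assms(2,3) unfolding Tseqs_def block_seq_def
  by (auto intro!: block_sum_closed block_sum_precsim1 sized_rep_Mats[OF assms(1)])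

text \<open>Term by term the block sum is equivalent to \<open>mplus\<close>, and two indices can be
  raised to a common one. The right-hand side depends only on the ideals of \<open>u\<close> and
  \<open>u'\<close>, so the class of the sum is independent of sizes and representatives.\<close>

lemma block_seq_down:
  assumes k: "sized_rep R k u" and u: "u \<in> Tseqs R" "u' \<in> Tseqs R"
  shows "M.down (block_seq k u u')
    = {c \<in> Minf R. \<exists>a\<in>M.down u. \<exists>b\<in>M.down u'. precsim1 R c (mplus a b)}"
proof (intro subset_antisym subsetI)
  note M = M.chain_in[OF u(1)[folded chain_iff]] M.chain_in[OF u(2)[folded chain_iff]]
  note simil = block_sum_precsim1_mplus[OF sized_rep_Mats[OF k] M(2)]
  fix c
  show "c \<in> {c \<in> Minf R. \<exists>a\<in>M.down u. \<exists>b\<in>M.down u'. precsim1 R c (mplus a b)}"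
    if c: "c \<in> M.down (block_seq k u u')"
  proof -
    obtain n where "precsim1 R c (block_sum R (k (Suc n)) (k n) (u n) (u' n))" "c \<in> Minf R"
      using c by (auto simp: M.down_def block_seq_def)
    then have "precsim1 R c (mplus (u n) (u' n))"
      using precsim1_trans[OF _ simil(1) mplus_closed[OF M]] by simp
    moreover have "u n \<in> M.down u" "u' n \<in> M.down u'"
      using M.chain_in_down u chain_iff by auto
    ultimately show ?thesis using \<open>c \<in> Minf R\<close> by blast
  qed
  show "c \<in> M.down (block_seq k u u')"
    if c: "c \<in> {c \<in> Minf R. \<exists>a\<in>M.down u. \<exists>b\<in>M.down u'. precsim1 R c (mplus a b)}"
  proof -
    obtain a b m n where ab: "precsim1 R a (u m)" "precsim1 R b (u' n)" "a \<in> Minf R" "b \<in> Minf R"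
      and c': "c \<in> Minf R" "precsim1 R c (mplus a b)"
      using c by (auto simp: M.down_def)
    let ?N = "max m n"
    have "precsim1 R a (u ?N)"
      using precsim1_trans[OF ab(1) M.chain_mono[of u m ?N] M(1)] u(1) chain_iff by simp
    moreover have "precsim1 R b (u' ?N)"
      using precsim1_trans[OF ab(2) M.chain_mono[of u' n ?N] M(2)] u(2) chain_iff by simp
    ultimately have "precsim1 R (mplus a b) (mplus (u ?N) (u' ?N))"
      using ab M by (intro M.plus_mono)
    from precsim1_trans[OF precsim1_trans[OF c'(2) this mplus_closed[OF M]] simil(2)]
    have "precsim1 R c (block_seq k u u' ?N)"
      unfolding block_seq_def using M block_sum_closed by simp
    then show ?thesis using c' by (auto simp: M.down_def)
  qed
qed

lemma Lambda_mult:
  assumes u: "u \<in> Tseqs R" "u' \<in> Tseqs R" and k: "sized_rep R k u"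
  shows "Lambda_class R u \<otimes>\<^bsub>Lambda R\<^esub> Lambda_class R u' = Lambda_class R (block_seq k u u')"
proof -
  let ?C = "Lambda_class R (block_seq k u u')"
  let ?A = "{Lambda_class R (\<lambda>n. block_sum R (k (Suc n)) (k n) (w n) (w' n)) | k k' w w'.
       w \<in> Lambda_class R u \<and> w' \<in> Lambda_class R u' \<and> sized_rep R k w \<and> sized_rep R k' w'}"
  have eq: "Lambda_class R (block_seq l w w') = ?C"
    if w: "w \<in> Lambda_class R u" "w' \<in> Lambda_class R u'" and l: "sized_rep R l w" for l w w'
  proof -
    have "w \<in> Tseqs R" "w' \<in> Tseqs R" "M.down w = M.down u" "M.down w' = M.down u'"
      using w u by (auto simp: Lambda_class_eq)
    then show ?thesis
      using u k l by (simp add: Lambda_class_eq_iff block_seq_Tseqs block_seq_down)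
  qed
  \<comment> \<open>A size sequence for the second summand makes the family of resulting classes
    nonempty, so its union is the one class \<open>?C\<close>.\<close>
  obtain k' where k': "sized_rep R k' u'" using ex_sized_rep u by blast
  have self: "u \<in> Lambda_class R u" "u' \<in> Lambda_class R u'" using u by (auto simp: Lambda_class_eq)
  have "?A = {?C}"
  proof
    show "?A \<subseteq> {?C}" using eq unfolding block_seq_def by blast
    show "{?C} \<subseteq> ?A" using self k k' unfolding block_seq_def by blast
  qed
  then show ?thesis by (simp add: Lambda_def)
qed

sublocale L: sequential_completion "Minf R" "precsim1 R" mplus "\<lambda>i j. \<zero>" "Lambda R" compacts
proof
  fix X assume "X \<in> carrier (Lambda R)"
  then show "\<exists>a. M.chain a \<and> compacts X = M.down a"
    using compacts_class by (auto simp: chain_iff carrier_Lambda)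
next
  fix a assume "M.chain a"
  then show "\<exists>X\<in>carrier (Lambda R). compacts X = M.down a"
    using compacts_class by (auto simp: chain_iff carrier_Lambda)
next
  fix X Y assume XY: "X \<in> carrier (Lambda R)" "Y \<in> carrier (Lambda R)"
  then obtain a b where ab: "a \<in> Tseqs R" "b \<in> Tseqs R" "X = Lambda_class R a" "Y = Lambda_class R b"
    by (auto simp: carrier_Lambda)
  obtain k where k: "sized_rep R k a" using ex_sized_rep ab by blast
  show "X = Y" if "compacts X = compacts Y"
    using that ab by (simp add: compacts_class Lambda_class_eq_iff)
  show "X \<unlhd>\<^bsub>Lambda R\<^esub> Y \<longleftrightarrow> compacts X \<subseteq> compacts Y"
  proof
    assume "X \<unlhd>\<^bsub>Lambda R\<^esub> Y"
    then obtain u v where "u \<in> X" "v \<in> Y" "precsim R u v" by (auto simp: Lambda_def)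
    then show "compacts X \<subseteq> compacts Y"
      using ab by (simp add: compacts_class) (simp add: Lambda_class_eq precsim_iff)
  next
    assume "compacts X \<subseteq> compacts Y"
    then have "precsim R a b" using ab by (simp add: compacts_class precsim_iff)
    then show "X \<unlhd>\<^bsub>Lambda R\<^esub> Y"
      using ab by (auto simp: Lambda_def Lambda_class_eq)
  qed
  show "X \<otimes>\<^bsub>Lambda R\<^esub> Y \<in> carrier (Lambda R)"
    using ab k by (simp add: Lambda_mult carrier_Lambda block_seq_Tseqs)
  show "compacts (X \<otimes>\<^bsub>Lambda R\<^esub> Y)
    = {c \<in> Minf R. \<exists>a\<in>compacts X. \<exists>b\<in>compacts Y. precsim1 R c (mplus a b)}"
    using ab k by (simp add: Lambda_mult compacts_class block_seq_Tseqs block_seq_down)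
next
  have "(\<lambda>n i j. \<zero>) \<in> Tseqs R"
    using M.chain_const[OF zero_in_Minf] by (simp add: chain_iff)
  then show "\<one>\<^bsub>Lambda R\<^esub> \<in> carrier (Lambda R)" "compacts \<one>\<^bsub>Lambda R\<^esub> = {c \<in> Minf R. precsim1 R c (\<lambda>i j. \<zero>)}"
    by (simp_all add: compacts_class M.down_const carrier_Lambda) (simp_all add: Lambda_def compacts_class M.down_const)
qed

section \<open>The submonoid \<open>S(R)\<close> and its closure under suprema\<close>

definition s_seq :: "'a mseq \<Rightarrow> bool" where
  "s_seq x \<longleftrightarrow> x \<in> Tseqs R \<and> (\<forall>n. \<exists>y\<in>Minf R. mtx_mult R (mtx_mult R y (x (Suc n))) (x n) = x n)"

lemma Smon_eq: "Smon R = {Lambda_class R x | x. s_seq x}"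
  by (simp add: Smon_def s_seq_def)

text \<open>The left factor for the block sum is the block sum of the left factors; the first of
  them is truncated to the sizes given by \<open>k\<close> so that the blocks line up.\<close>

lemma s_seq_block_seq:
  assumes k: "sized_rep R k u" and u: "s_seq u" "s_seq u'"
  shows "s_seq (block_seq k u u')"
  unfolding s_seq_def
proof (intro conjI allI)
  have T: "u \<in> Tseqs R" "u' \<in> Tseqs R" using u by (auto simp: s_seq_def)
  then show "block_seq k u u' \<in> Tseqs R" using k block_seq_Tseqs by blast
  fix n
  let ?k0 = "k n" and ?k1 = "k (Suc n)" and ?k2 = "k (Suc (Suc n))"
  note kM = sized_rep_Mats[OF k]
  have M: "u m \<in> Minf R" "u' m \<in> Minf R" for m using T by (auto simp: Tseqs_def)
  obtain y where y: "y \<in> Minf R" "mtx_mult R (mtx_mult R y (u (Suc n))) (u n) = u n"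
    using u by (auto simp: s_seq_def)
  obtain y' where y': "y' \<in> Minf R" "mtx_mult R (mtx_mult R y' (u' (Suc n))) (u' n) = u' n"
    using u by (auto simp: s_seq_def)
  let ?y = "mtx_trunc ?k1 ?k2 y"
  have "mtx_mult R ?y (mtx_trunc ?k2 ?k1 (u (Suc n))) = mtx_trunc ?k1 ?k1 (mtx_mult R y (u (Suc n)))"
    using y M MatsD(2)[OF kM] by (intro mtx_trunc_mult) auto
  then have 1: "mtx_mult R ?y (u (Suc n)) = mtx_trunc ?k1 ?k1 (mtx_mult R y (u (Suc n)))"
    by (simp add: mtx_trunc_Mats[OF kM])
  have "mtx_mult R (mtx_trunc ?k1 ?k1 (mtx_mult R y (u (Suc n)))) (mtx_trunc ?k1 ?k0 (u n))
      = mtx_trunc ?k1 ?k0 (mtx_mult R (mtx_mult R y (u (Suc n))) (u n))"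
    using y M MatsD(2)[OF kM] by (intro mtx_trunc_mult mtx_mult_closed) auto
  then have 2: "mtx_mult R (mtx_mult R ?y (u (Suc n))) (u n) = u n"
    by (simp add: mtx_trunc_Mats[OF kM] y 1)
  have yM: "?y \<in> Mats R ?k1 ?k2" using y(1) by (rule mtx_trunc_in_Mats)
  have "mtx_mult R (mtx_mult R (block_sum R ?k1 ?k2 ?y y') (block_seq k u u' (Suc n))) (block_seq k u u' n)
      = block_seq k u u' n"
    unfolding block_seq_def
    using yM kM y' M
    by (simp add: block_sum_mult mtx_mult_in_Mats[OF yM kM] mtx_mult_closed 2)
  moreover have "block_sum R ?k1 ?k2 ?y y' \<in> Minf R"
    using yM y' Mats_subset_Minf by (intro block_sum_closed) auto
  ultimately show "\<exists>y\<in>Minf R. mtx_mult R (mtx_mult R y (block_seq k u u' (Suc n))) (block_seq k u u' n)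
      = block_seq k u u' n" by blast
qed

lemma Smon_submonoid: "submonoid (Smon R) (Lambda R)"
proof
  show "Smon R \<subseteq> carrier (Lambda R)" by (auto simp: Smon_def carrier_Lambda)
  show "X \<otimes>\<^bsub>Lambda R\<^esub> Y \<in> Smon R" if XY: "X \<in> Smon R" "Y \<in> Smon R" for X Y
  proof -
    obtain u u' where u: "X = Lambda_class R u" "Y = Lambda_class R u'" "s_seq u" "s_seq u'"
      using XY by (auto simp: Smon_eq)
    then have T: "u \<in> Tseqs R" "u' \<in> Tseqs R" by (auto simp: s_seq_def)
    obtain k where k: "sized_rep R k u" using ex_sized_rep T by blast
    show ?thesis using Lambda_mult[OF T k] s_seq_block_seq[OF k u(3,4)] u by (auto simp: Smon_eq)
  qed
  have "mtx_mult R a (\<lambda>i j. \<zero>) = (\<lambda>i j. \<zero>)" if "a \<in> Minf R" for a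
    using mtx_mult_eq_finsum[OF that zero_in_Minf, of "{}"] by (intro ext) simp
  moreover have "(\<lambda>n i j. \<zero>) \<in> Tseqs R"
    using M.chain_const[OF zero_in_Minf] by (simp add: chain_iff)
  ultimately have "s_seq (\<lambda>n i j. \<zero>)"
    using zero_in_Minf by (auto simp: s_seq_def)
  then show "\<one>\<^bsub>Lambda R\<^esub> \<in> Smon R" by (auto simp: Smon_eq Lambda_def)
qed

text \<open>With \<open>b = r b t\<close> from reflexivity, \<open>g b\<close> equals
  \<open>(g r) b t\<close>, which supplies the missing right factor.\<close>

lemma precsim1_left_factor:
  assumes "a = mtx_mult R g b" "g \<in> Minf R" "b \<in> Minf R"
  shows "precsim1 R a b"
proof -
  obtain r t where rt: "r \<in> Minf R" "t \<in> Minf R" "b = mtx_mult R (mtx_mult R r b) t"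
    using precsim1_refl[OF assms(3)] by (auto simp: precsim1_def)
  have "a = mtx_mult R (mtx_mult R (mtx_mult R g r) b) t"
    using assms rt by (metis mtx_mult_assoc mtx_mult_closed)
  then show ?thesis using assms rt mtx_mult_closed precsim1I by blast
qed

text \<open>The defining condition of \<open>S(R)\<close> concerns representatives, and the diagonal
  sequence itself may fail it; an equivalent sequence that satisfies it takes its place.\<close>

lemma Smon_sup:
  assumes X: "weakly_increasing (Lambda R) X" and S: "range X \<subseteq> Smon R"
  shows "\<exists>s\<in>Smon R. is_seq_sup (Lambda R) X s"
proof -
  have "\<exists>x. X i = Lambda_class R x \<and> s_seq x" for i using S by (auto simp: Smon_eq)
  then have "\<forall>i. \<exists>x. X i = Lambda_class R x \<and> s_seq x" by blast
  from choice[OF this] obtain x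
    where x: "\<And>i. X i = Lambda_class R (x i)" "\<And>i. s_seq (x i)" by blast
  then have T: "x i \<in> Tseqs R" for i by (auto simp: s_seq_def)
  have chain: "M.chain (x i)" for i using T chain_iff by blast
  have D: "compacts (X i) = M.down (x i)" for i using x T compacts_class by simp
  have "\<exists>m0. \<forall>m\<ge>m0. x i n \<in> M.down (x m)" for i n
    using L.weakly_increasing_D[OF X, of "x i n" i] M.chain_in_down[OF chain] by (simp add: D)
  then obtain \<iota> \<nu>
    where step: "\<And>k. precsim1 R (x (\<iota> k) (Suc (\<nu> k))) (x (\<iota> (Suc k)) (\<nu> (Suc k)))"
      and cof: "\<And>i n. \<exists>k. precsim1 R (x i n) (x (\<iota> k) (\<nu> k))"
    using M.cofinal_diagonal[of x] chain by blast
  define u where "u k = x (\<iota> k) (\<nu> k)" for k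
  have u: "M.chain u" "M.down u = (\<Union>i. M.down (x i))"
    using M.cofinal_diagonal_down[of x \<iota> \<nu>] chain step cof by (simp_all add: u_def[abs_def])
  note uM = M.chain_in[OF u(1)]
  have "\<exists>g t. g \<in> Minf R \<and> t \<in> Minf R \<and>
      u k = mtx_mult R (mtx_mult R g (u (Suc k))) (mtx_mult R t (u k))" for k
  proof -
    let ?v = "x (\<iota> k) (Suc (\<nu> k))"
    obtain y where y: "y \<in> Minf R" "mtx_mult R (mtx_mult R y ?v) (u k) = u k"
      using x(2)[of "\<iota> k"] by (auto simp: s_seq_def u_def)
    \<comment> \<open>The extra step of the diagonal makes the successor \<open>?v\<close> in the
      same chain factor through \<open>u (Suc k)\<close>; substituting this into
      \<open>y ?v (u k) = u k\<close> gives the factorization.\<close>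
    obtain r t where rt: "r \<in> Minf R" "t \<in> Minf R" "?v = mtx_mult R (mtx_mult R r (u (Suc k))) t"
      using step[of k] by (auto simp: precsim1_def u_def)
    have "u k = mtx_mult R (mtx_mult R y (mtx_mult R (mtx_mult R r (u (Suc k))) t)) (u k)"
      using y(2) rt(3) by simp
    also have "\<dots> = mtx_mult R (mtx_mult R (mtx_mult R y r) (u (Suc k))) (mtx_mult R t (u k))"
      using y(1) rt(1,2) uM by (simp add: mtx_mult_assoc mtx_mult_closed)
    finally have "u k = mtx_mult R (mtx_mult R (mtx_mult R y r) (u (Suc k))) (mtx_mult R t (u k))" .
    then show ?thesis using y rt mtx_mult_closed by blast
  qed
  then obtain g t where gt: "\<And>k. g k \<in> Minf R" "\<And>k. t k \<in> Minf R"
    and u_eq: "\<And>k. u k = mtx_mult R (mtx_mult R (g k) (u (Suc k))) (mtx_mult R (t k) (u k))"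
    by metis
  \<comment> \<open>The factor \<open>t k\<close> is absorbed into the sequence. Each of
    \<open>u k\<close> and \<open>z k\<close> is a left multiple of the other, hence they are
    equivalent.\<close>
  define z where "z k = mtx_mult R (t k) (u k)" for k
  have u_z: "u k = mtx_mult R (mtx_mult R (g k) (u (Suc k))) (z k)" for k
    using u_eq by (simp add: z_def)
  have zM: "z k \<in> Minf R" for k using gt uM by (simp add: z_def mtx_mult_closed)
  have zu: "precsim1 R (z k) (u k)" for k
    using z_def gt uM by (intro precsim1_left_factor)
  have uz: "precsim1 R (u k) (z k)" for k
    by (rule precsim1_left_factor[OF u_z mtx_mult_closed[OF gt(1) uM] zM])
  have "precsim1 R (z k) (z (Suc k))" for k
    using precsim1_trans[OF precsim1_trans[OF zu _ uM] uz zM] u(1) unfolding M.chain_def by blast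
  then have zT: "z \<in> Tseqs R" using zM by (simp add: Tseqs_def)
  have "precsim1 R c (z n) \<longleftrightarrow> precsim1 R c (u n)" for c n
    using precsim1_trans[OF _ zu uM] precsim1_trans[OF _ uz zM] by blast
  then have "M.down z = M.down u"
    by (simp add: M.down_def)
  moreover have "s_seq z"
    unfolding s_seq_def
  proof (intro conjI allI zT)
    fix k
    let ?h = "\<lambda>k. mtx_mult R (g k) (u (Suc k))"
    \<comment> \<open>Arises by inserting \<open>u (Suc k) = ?h (Suc k) z (Suc k)\<close> into
      \<open>z k = t k g k u (Suc k) z k\<close>.\<close>
    let ?y = "mtx_mult R (mtx_mult R (t k) (g k)) (?h (Suc k))"
    have h: "?h k \<in> Minf R" for k using gt uM mtx_mult_closed by blast
    have "z k = mtx_mult R (t k) (mtx_mult R (mtx_mult R (g k) (u (Suc k))) (z k))"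
      using u_z z_def by simp
    also have "\<dots> = mtx_mult R (mtx_mult R (mtx_mult R (t k) (g k)) (u (Suc k))) (z k)"
      using gt uM zM by (simp add: mtx_mult_assoc mtx_mult_closed)
    also have "\<dots> = mtx_mult R (mtx_mult R (mtx_mult R (t k) (g k))
        (mtx_mult R (?h (Suc k)) (z (Suc k)))) (z k)"
      using u_z[of "Suc k"] by simp
    also have "\<dots> = mtx_mult R (mtx_mult R ?y (z (Suc k))) (z k)"
      using gt zM h by (simp add: mtx_mult_assoc mtx_mult_closed)
    finally show "\<exists>y\<in>Minf R. mtx_mult R (mtx_mult R y (z (Suc k))) (z k) = z k"
      using gt h mtx_mult_closed by metis
  qed
  ultimately show ?thesis
    using u(2) D zT compacts_class[OF zT]
    by (intro bexI[of _ "Lambda_class R z"])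
      (auto simp: L.is_seq_sup_iff_D_weakly_increasing[OF X] carrier_Lambda Smon_eq)
qed

lemma SCu_object: "SCu_object (Lambda R, Smon R)"
  using L.Cu_semigroup Smon_submonoid Smon_sup by (auto simp: SCu_object_def)

end

section \<open>Functoriality\<close>

definition map_mtx :: "('a \<Rightarrow> 'b) \<Rightarrow> 'a mtx \<Rightarrow> 'b mtx" where
  "map_mtx f a = (\<lambda>i j. f (a i j))"

text \<open>The two carrier types may differ, so the results are not confined to a single
  universe.\<close>

locale ws_unital_ring_hom = R: ws_unital_ring R + R': ws_unital_ring R'
  for R :: "'a ring" and R' :: "'b ring" +
  fixes f :: "'a \<Rightarrow> 'b"
  assumes hom: "f \<in> nonunital_hom R R'"
begin

lemma f_closed: "x \<in> carrier R \<Longrightarrow> f x \<in> carrier R'"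
  and f_add: "\<lbrakk>x \<in> carrier R; y \<in> carrier R\<rbrakk> \<Longrightarrow> f (x \<oplus>\<^bsub>R\<^esub> y) = f x \<oplus>\<^bsub>R'\<^esub> f y"
  and f_mult: "\<lbrakk>x \<in> carrier R; y \<in> carrier R\<rbrakk> \<Longrightarrow> f (x \<otimes>\<^bsub>R\<^esub> y) = f x \<otimes>\<^bsub>R'\<^esub> f y"
  using hom by (auto simp: nonunital_hom_def hom_def)

lemma f_zero: "f \<zero>\<^bsub>R\<^esub> = \<zero>\<^bsub>R'\<^esub>"
proof -
  have "f \<zero>\<^bsub>R\<^esub> \<oplus>\<^bsub>R'\<^esub> f \<zero>\<^bsub>R\<^esub> = f \<zero>\<^bsub>R\<^esub>"
    using f_add[of "\<zero>\<^bsub>R\<^esub>" "\<zero>\<^bsub>R\<^esub>"] by simp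
  then show ?thesis using f_closed[of "\<zero>\<^bsub>R\<^esub>"] R'.add.l_cancel_one by simp
qed

lemma f_finsum:
  assumes "finite A" "\<And>i. g i \<in> carrier R"
  shows "f (finsum R g A) = finsum R' (\<lambda>i. f (g i)) A"
  using assms(1)
  by induction (simp_all add: assms f_zero f_add f_closed Pi_def)

lemma map_mtx_Mats: "a \<in> Mats R k l \<Longrightarrow> map_mtx f a \<in> Mats R' k l"
  by (auto simp: Mats_def map_mtx_def f_closed f_zero)

lemma map_mtx_Minf:
  assumes "a \<in> Minf R"
  shows "map_mtx f a \<in> Minf R'"
proof -
  obtain n where "a \<in> Mats R n n" using R.common_Mats[of "{a}"] assms by auto
  then show ?thesis by (rule map_mtx_Mats[THEN subsetD[OF R'.Mats_subset_Minf]])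
qed

lemma map_mtx_mult:
  assumes "a \<in> Minf R" "b \<in> Minf R"
  shows "map_mtx f (mtx_mult R a b) = mtx_mult R' (map_mtx f a) (map_mtx f b)"
proof -
  obtain n where n: "a \<in> Mats R n n" "b \<in> Mats R n n"
    using R.common_Mats[of "{a, b}"] assms by auto
  show ?thesis
    using R.mtx_mult_Mats_eq[OF n] R'.mtx_mult_Mats_eq[OF n[THEN map_mtx_Mats]]
      R.MatsD(1)[OF n(1)] R.MatsD(1)[OF n(2)]
    by (intro ext) (simp add: map_mtx_def f_finsum f_mult R.mult_closed)
qed

lemma map_mtx_precsim1:
  assumes "precsim1 R a b" "b \<in> Minf R"
  shows "precsim1 R' (map_mtx f a) (map_mtx f b)"
proof -
  obtain r t where rt: "r \<in> Minf R" "t \<in> Minf R" "a = mtx_mult R (mtx_mult R r b) t"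
    using assms by (auto simp: precsim1_def)
  show ?thesis
    by (rule R'.precsim1I[of _ "map_mtx f r" _ "map_mtx f t"])
      (use rt assms in \<open>auto simp: map_mtx_mult map_mtx_Minf R.mtx_mult_closed\<close>)
qed

lemma map_mtx_block_sum:
  "map_mtx f (block_sum R k l a b) = block_sum R' k l (map_mtx f a) (map_mtx f b)"
  by (intro ext) (auto simp: map_mtx_def block_sum_def f_zero)

section \<open>Images of sequences and the induced map on classes\<close>

lemma map_mseq_map_mtx: "map_mseq f x n = map_mtx f (x n)"
  by (simp add: map_mseq_def map_mtx_def)

lemma map_mseq_Tseqs: "x \<in> Tseqs R \<Longrightarrow> map_mseq f x \<in> Tseqs R'"
  by (auto simp: Tseqs_def map_mseq_map_mtx map_mtx_Minf map_mtx_precsim1)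

text \<open>Entrywise application preserves \<open>precsim1\<close>. Hence the ideal of the image
  depends only on the ideal of \<open>x\<close>, which makes the map on classes well
  defined.\<close>

lemma down_map_mseq:
  assumes "x \<in> Tseqs R"
  shows "R'.M.down (map_mseq f x) = {c \<in> Minf R'. \<exists>a\<in>R.M.down x. precsim1 R' c (map_mtx f a)}"
proof (intro subset_antisym subsetI)
  note chain = assms[folded R.chain_iff]
  fix c
  show "c \<in> {c \<in> Minf R'. \<exists>a\<in>R.M.down x. precsim1 R' c (map_mtx f a)}"
    if "c \<in> R'.M.down (map_mseq f x)"
    using that R.M.chain_in_down[OF chain] by (auto simp: R'.M.down_def map_mseq_map_mtx)
  show "c \<in> R'.M.down (map_mseq f x)"
    if c: "c \<in> {c \<in> Minf R'. \<exists>a\<in>R.M.down x. precsim1 R' c (map_mtx f a)}"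
  proof -
    obtain a n where a: "c \<in> Minf R'" "precsim1 R' c (map_mtx f a)" "precsim1 R a (x n)"
      using c by (auto simp: R.M.down_def)
    have "x n \<in> Minf R" using R.M.chain_in[OF chain] .
    then have "precsim1 R' c (map_mtx f (x n))"
      using R'.precsim1_trans[OF a(2) map_mtx_precsim1[OF a(3)]] map_mtx_Minf by blast
    then show ?thesis using a(1) by (auto simp: R'.M.down_def map_mseq_map_mtx)
  qed
qed

lemma Lambda_map_class:
  assumes x: "x \<in> Tseqs R"
  shows "Lambda_map R R' f (Lambda_class R x) = Lambda_class R' (map_mseq f x)"
proof -
  have "Lambda_class R' (map_mseq f y) = Lambda_class R' (map_mseq f x)"
    if "y \<in> Lambda_class R x" for y
    using that x by (simp add: R.Lambda_class_eq R'.Lambda_class_eq_iff map_mseq_Tseqs down_map_mseq)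
  moreover have "x \<in> Lambda_class R x" using x by (simp add: R.Lambda_class_eq)
  ultimately have "{Lambda_class R' (map_mseq f y) | y. y \<in> Lambda_class R x}
      = {Lambda_class R' (map_mseq f x)}"
    by blast
  then show ?thesis using x by (simp add: Lambda_map_def R.carrier_Lambda)
qed

lemma Lambda_map_Cu_morphism: "Lambda_map R R' f \<in> Cu_morphisms (Lambda R) (Lambda R')"
proof (rule Cu_morphismI[OF R.L.sequential_completion_axioms R'.L.sequential_completion_axioms])
  fix a b assume ab: "a \<in> Minf R" "b \<in> Minf R"
  show "precsim1 R' (map_mtx f (R.mplus a b)) (R'.mplus (map_mtx f a) (map_mtx f b))"
    "precsim1 R' (R'.mplus (map_mtx f a) (map_mtx f b)) (map_mtx f (R.mplus a b))"
    \<comment> \<open>Entrywise application keeps the size \<open>msize a\<close>, while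
      \<open>mplus\<close> over the target takes the possibly smaller size of the image; the two
      sums are therefore compared up to equivalence.\<close>
    using R'.block_sum_precsim1_mplus[OF map_mtx_Mats[OF R.msize[OF ab(1)]] map_mtx_Minf[OF ab(2)]]
    by (simp_all add: R.mplus_def map_mtx_block_sum)
next
  show "precsim1 R' (map_mtx f (\<lambda>i j. \<zero>\<^bsub>R\<^esub>)) (\<lambda>i j. \<zero>\<^bsub>R'\<^esub>)"
    using R'.precsim1_refl R'.zero_in_Minf by (simp add: map_mtx_def f_zero)
next
  fix X assume "X \<in> carrier (Lambda R)"
  then obtain x where x: "x \<in> Tseqs R" "X = Lambda_class R x" by (auto simp: R.carrier_Lambda)
  then show "Lambda_map R R' f X \<in> carrier (Lambda R')"
    by (simp add: Lambda_map_class R'.carrier_Lambda map_mseq_Tseqs)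
  show "R'.compacts (Lambda_map R R' f X)
      = {c \<in> Minf R'. \<exists>a\<in>R.compacts X. precsim1 R' c (map_mtx f a)}"
    using x by (simp add: Lambda_map_class R.compacts_class R'.compacts_class map_mseq_Tseqs down_map_mseq)
qed (auto simp: map_mtx_Minf map_mtx_precsim1)

lemma s_seq_map_mseq:
  assumes "R.s_seq x"
  shows "R'.s_seq (map_mseq f x)"
  unfolding R'.s_seq_def
proof (intro conjI allI)
  have x: "x \<in> Tseqs R" using assms by (simp add: R.s_seq_def)
  then show "map_mseq f x \<in> Tseqs R'" by (rule map_mseq_Tseqs)
  fix n
  have M: "x m \<in> Minf R" for m using x by (simp add: Tseqs_def)
  obtain y where y: "y \<in> Minf R" "mtx_mult R (mtx_mult R y (x (Suc n))) (x n) = x n"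
    using assms by (auto simp: R.s_seq_def)
  have "mtx_mult R' (mtx_mult R' (map_mtx f y) (map_mseq f x (Suc n))) (map_mseq f x n)
      = map_mtx f (mtx_mult R (mtx_mult R y (x (Suc n))) (x n))"
    using y(1) M by (simp add: map_mseq_map_mtx map_mtx_mult R.mtx_mult_closed)
  then show "\<exists>y\<in>Minf R'. mtx_mult R' (mtx_mult R' y (map_mseq f x (Suc n))) (map_mseq f x n)
      = map_mseq f x n"
    using y map_mtx_Minf by (auto simp: map_mseq_map_mtx)
qed

lemma Lambda_map_SCu_morphism:
  "Lambda_map R R' f \<in> SCu_morphisms (Lambda R, Smon R) (Lambda R', Smon R')"
proof -
  have "Lambda_map R R' f X \<in> Smon R'" if X: "X \<in> Smon R" for X
  proof -
    obtain x where x: "X = Lambda_class R x" "R.s_seq x" using X by (auto simp: R.Smon_eq)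
    then have "x \<in> Tseqs R" by (simp add: R.s_seq_def)
    then show ?thesis
      using x s_seq_map_mseq by (auto simp: Lambda_map_class R'.Smon_eq)
  qed
  then show ?thesis using Lambda_map_Cu_morphism by (auto simp: SCu_morphisms_def)
qed

end

section \<open>The two categories and the functor laws\<close>

lemma Lambda_map_extensional: "Lambda_map R R' f \<in> extensional (carrier (Lambda R))"
  by (simp add: Lambda_map_def)

lemma ws_unital_ring_iff: "ws_unital_ring R \<longleftrightarrow> nonunital_ring R \<and> weakly_s_unital R"
  by (simp add: ws_unital_ring_def ws_unital_ring_axioms_def)

lemma nonunital_hom_compose:
  assumes "f \<in> nonunital_hom R R'" "g \<in> nonunital_hom R' R''" "nonunital_ring R"
  shows "compose (carrier R) g f \<in> nonunital_hom R R''"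
proof -
  interpret nonunital_ring R by (rule assms(3))
  show ?thesis
    using assms(1,2) by (auto simp: nonunital_hom_def hom_def compose_def mult_closed Pi_iff)
qed

lemma is_category_Rings_ws: "is_category (Rings_ws :: ('a ring, 'a \<Rightarrow> 'a) cat)"
proof -
  have id: "(\<lambda>x\<in>carrier R. x) \<in> nonunital_hom R R" if "nonunital_ring R" for R :: "'a ring"
  proof -
    interpret nonunital_ring R by (rule that)
    show ?thesis by (auto simp: nonunital_hom_def hom_def mult_closed)
  qed
  have closed: "f x \<in> carrier R'" if "f \<in> nonunital_hom R R'" "x \<in> carrier R"
    for f x and R R' :: "'a ring"
    using that by (auto simp: nonunital_hom_def hom_def)
  show ?thesis
    unfolding is_category_def Rings_ws_def
    by (auto simp: id intro: nonunital_hom_compose)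
      (auto simp: compose_def extensional_def fun_eq_iff closed)
qed

lemma increasing_image:
  assumes f: "f \<in> Cu_morphisms S T" and x: "increasing S x"
  shows "increasing T (\<lambda>n. f (x n))"
  using assms unfolding Cu_morphisms_def increasing_def hom_def by auto

text \<open>Restricted composites are computed only on the carrier, so terms and suprema are first
  placed there. The image sequence under \<open>f\<close> is increasing, as preservation of suprema
  by \<open>g\<close> requires.\<close>

lemma Cu_morphisms_compose:
  assumes S: "Cu_semigroup S" and f: "f \<in> Cu_morphisms S T" and g: "g \<in> Cu_morphisms T U"
  shows "compose (carrier S) g f \<in> Cu_morphisms S U"
proof -
  interpret Cu_semigroup S by (rule S)
  have c: "f x \<in> carrier T" if "x \<in> carrier S" for x
    using f that by (auto simp: Cu_morphisms_def hom_def)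
  have wb: "way_below U (compose (carrier S) g f x) (compose (carrier S) g f y)"
    if "way_below S x y" for x y
  proof -
    have "x \<in> carrier S" "y \<in> carrier S" using that by (auto simp: way_below_def)
    then show ?thesis using f g that by (simp add: Cu_morphisms_def compose_eq)
  qed
  have sup: "is_seq_sup U (\<lambda>n. compose (carrier S) g f (x n)) (compose (carrier S) g f s)"
    if x: "increasing S x" and s: "is_seq_sup S x s" for x s
  proof -
    have S: "x n \<in> carrier S" for n using x by (simp add: increasing_def)
    then have "s \<in> carrier S" using s by (simp add: is_seq_sup_iff)
    moreover have "is_seq_sup T (\<lambda>n. f (x n)) (f s)" using f x s by (simp add: Cu_morphisms_def)
    then have "is_seq_sup U (\<lambda>n. g (f (x n))) (g (f s))"
      using g increasing_image[OF f x] by (simp add: Cu_morphisms_def)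
    ultimately show ?thesis using S by (simp add: compose_eq)
  qed
  show ?thesis
    unfolding Cu_morphisms_def
    using f g c wb sup by (auto simp: Cu_morphisms_def hom_def compose_eq Pi_iff)
qed

lemma Cu_morphisms_id:
  assumes "Cu_semigroup S"
  shows "(\<lambda>x\<in>carrier S. x) \<in> Cu_morphisms S S"
proof -
  interpret Cu_semigroup S by (rule assms)
  \<comment> \<open>Preservation of suprema with the restricted identity unfolded; the terms and the
    supremum lie in the carrier.\<close>
  have "is_seq_sup S (\<lambda>n. if x n \<in> carrier S then x n else undefined)
      (if s \<in> carrier S then s else undefined)"
    if x: "increasing S x" and s: "is_seq_sup S x s" for x s
  proof -
    have S: "x n \<in> carrier S" for n using x by (simp add: increasing_def)
    then have "s \<in> carrier S" using s by (simp add: is_seq_sup_iff)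
    then show ?thesis using S s by simp
  qed
  then show ?thesis
    by (auto simp: Cu_morphisms_def hom_def way_below_def restrict_def)
qed

lemma is_category_SCu_cat: "is_category (SCu_cat :: ('a pom \<times> 'a set, 'a \<Rightarrow> 'a) cat)"
proof -
  have id: "(\<lambda>x\<in>carrier (fst P). x) \<in> SCu_morphisms P P" if P: "SCu_object P" for P :: "'a pom \<times> 'a set"
    using P Cu_morphisms_id
    by (auto simp: SCu_object_def SCu_morphisms_def split: prod.splits dest: submonoid.subset)
  have comp: "compose (carrier (fst P)) g f \<in> SCu_morphisms P U"
    if P: "SCu_object P" and f: "f \<in> SCu_morphisms P Q" and g: "g \<in> SCu_morphisms Q U"
    for P Q U :: "'a pom \<times> 'a set" and f g
  proof -
    obtain S W T V U' X where eq: "P = (S, W)" "Q = (T, V)" "U = (U', X)" by (metis surj_pair)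
    \<comment> \<open>Outside the carrier \<open>compose\<close> takes a default value, so the
      elements of \<open>W\<close> must be known to lie inside.\<close>
    have "W \<subseteq> carrier S" using P eq by (auto simp: SCu_object_def dest: submonoid.subset)
    then show ?thesis
      using P f g Cu_morphisms_compose[of S f T g U'] unfolding eq
      by (auto simp: SCu_object_def SCu_morphisms_def compose_eq subset_iff image_subset_iff)
  qed
  have closed: "f x \<in> carrier T" if "f \<in> SCu_morphisms (S, W) (T, V)" "x \<in> carrier S"
    for f x and S T :: "'a pom" and W V
    using that by (auto simp: SCu_morphisms_def Cu_morphisms_def hom_def)
  show ?thesis
    unfolding is_category_def SCu_cat_def
    by (auto simp: id intro: comp simp del: split_paired_All)
      (auto simp: compose_def extensional_def fun_eq_iff closed)
qed

lemma Lambda_map_id: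
  assumes "ws_unital_ring R"
  shows "Lambda_map R R (\<lambda>x\<in>carrier R. x) = (\<lambda>X\<in>carrier (Lambda R). X)"
proof -
  interpret ws_unital_ring R by (rule assms)
  interpret h: ws_unital_ring_hom R R "\<lambda>x\<in>carrier R. x"
    by unfold_locales (auto simp: nonunital_hom_def hom_def mult_closed)
  have "Lambda_map R R (\<lambda>x\<in>carrier R. x) X = X" if X: "X \<in> carrier (Lambda R)" for X
  proof -
    obtain x where x: "x \<in> Tseqs R" "X = Lambda_class R x" using X by (auto simp: carrier_Lambda)
    \<comment> \<open>All matrix entries lie in the carrier, where the restricted identity acts
      trivially.\<close>
    have "map_mseq (\<lambda>x\<in>carrier R. x) x = x"
      using x(1) by (auto simp: map_mseq_def Tseqs_def Minf_def)
    then show ?thesis using x h.Lambda_map_class by simp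
  qed
  then show ?thesis
    using Lambda_map_extensional by (intro extensionalityI[of _ "carrier (Lambda R)"]) auto
qed

text \<open>Both sides are extensional, so it suffices to compare them on a class, and there on a
  representative, where entrywise application respects composition.\<close>

lemma Lambda_map_compose:
  assumes R: "ws_unital_ring R" "ws_unital_ring R'" "ws_unital_ring R''"
    and f: "f \<in> nonunital_hom R R'" and g: "g \<in> nonunital_hom R' R''"
  shows "Lambda_map R R'' (compose (carrier R) g f)
    = compose (carrier (Lambda R)) (Lambda_map R' R'' g) (Lambda_map R R' f)"
proof -
  interpret R: ws_unital_ring R by (rule R(1))
  interpret f: ws_unital_ring_hom R R' f
    using R f by (simp add: ws_unital_ring_hom_def ws_unital_ring_hom_axioms_def)
  interpret g: ws_unital_ring_hom R' R'' g
    using R g by (simp add: ws_unital_ring_hom_def ws_unital_ring_hom_axioms_def)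
  interpret gf: ws_unital_ring_hom R R'' "compose (carrier R) g f"
    using R nonunital_hom_compose[OF f g R.nonunital_ring_axioms]
    by (simp add: ws_unital_ring_hom_def ws_unital_ring_hom_axioms_def)
  have "Lambda_map R R'' (compose (carrier R) g f) X = Lambda_map R' R'' g (Lambda_map R R' f X)"
    if X: "X \<in> carrier (Lambda R)" for X
  proof -
    obtain x where x: "x \<in> Tseqs R" "X = Lambda_class R x" using X by (auto simp: R.carrier_Lambda)
    have "map_mseq (compose (carrier R) g f) x = map_mseq g (map_mseq f x)"
      using x(1) by (auto simp: map_mseq_def Tseqs_def Minf_def compose_eq)
    then show ?thesis
      using x f.map_mseq_Tseqs f.Lambda_map_class g.Lambda_map_class gf.Lambda_map_class by simp
  qed
  then show ?thesis
    using Lambda_map_extensional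
    by (intro extensionalityI[of _ "carrier (Lambda R)"]) (auto simp: compose_eq)
qed

lemma is_functor_Lambda:
  "is_functor (Rings_ws :: ('a ring, 'a \<Rightarrow> 'a) cat)
      (SCu_cat :: ('a mseq set pom \<times> 'a mseq set set, 'a mseq set \<Rightarrow> 'a mseq set) cat)
      (\<lambda>R. (Lambda R, Smon R)) Lambda_map"
  unfolding is_functor_def
proof (intro conjI ballI is_category_Rings_ws is_category_SCu_cat)
  fix R :: "'a ring" assume "R \<in> Ob Rings_ws"
  then have R: "ws_unital_ring R" by (simp add: Rings_ws_def ws_unital_ring_iff)
  show "(Lambda R, Smon R) \<in> Ob SCu_cat"
    using ws_unital_ring.SCu_object[OF R] by (simp add: SCu_cat_def)
  show "Lambda_map R R (Ident Rings_ws R) = Ident SCu_cat (Lambda R, Smon R)"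
    using Lambda_map_id[OF R] by (simp add: SCu_cat_def Rings_ws_def)
  fix R' :: "'a ring" and f assume "R' \<in> Ob Rings_ws" and "f \<in> Hom Rings_ws R R'"
  then have R': "ws_unital_ring R'" and f: "f \<in> nonunital_hom R R'"
    by (simp_all add: Rings_ws_def ws_unital_ring_iff)
  show "Lambda_map R R' f \<in> Hom SCu_cat (Lambda R, Smon R) (Lambda R', Smon R')"
    using R R' f ws_unital_ring_hom.Lambda_map_SCu_morphism[of R R' f] Lambda_map_extensional
    by (simp add: SCu_cat_def ws_unital_ring_hom_def ws_unital_ring_hom_axioms_def)
  fix R'' :: "'a ring" and g assume "R'' \<in> Ob Rings_ws" and "g \<in> Hom Rings_ws R' R''"
  then have R'': "ws_unital_ring R''" and g: "g \<in> nonunital_hom R' R''"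
    by (simp_all add: Rings_ws_def ws_unital_ring_iff)
  show "Lambda_map R R'' (Comp Rings_ws R R' R'' g f) =
    Comp SCu_cat (Lambda R, Smon R) (Lambda R', Smon R') (Lambda R'', Smon R'')
      (Lambda_map R' R'' g) (Lambda_map R R' f)"
    using Lambda_map_compose[OF R R' R'' f g] by (simp add: SCu_cat_def Rings_ws_def)
qed

text \<open>The functor relates categories over one carrier type; the last conjunct covers
  homomorphisms between rings over two types and records the formula on representatives.\<close>

theorem theorem2:
  shows "is_functor (Rings_ws :: ('a ring, 'a \<Rightarrow> 'a) cat)
      (SCu_cat :: ('a mseq set pom \<times> 'a mseq set set, 'a mseq set \<Rightarrow> 'a mseq set) cat)
      (\<lambda>R. (Lambda R, Smon R)) Lambda_map
    \<and> (\<forall>R :: 'a ring. nonunital_ring R \<and> weakly_s_unital R \<longrightarrow> SCu_object (Lambda R, Smon R))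
    \<and> (\<forall>(R :: 'a ring) (R' :: 'b ring) f.
        nonunital_ring R \<and> weakly_s_unital R \<and> nonunital_ring R' \<and> weakly_s_unital R'
          \<and> f \<in> nonunital_hom R R' \<longrightarrow>
        Lambda_map R R' f \<in> SCu_morphisms (Lambda R, Smon R) (Lambda R', Smon R') \<and>
        (\<forall>x\<in>Tseqs R. map_mseq f x \<in> Tseqs R' \<and>
          Lambda_map R R' f (Lambda_class R x) = Lambda_class R' (map_mseq f x)))"
proof (intro conjI allI impI is_functor_Lambda)
  fix R :: "'a ring" assume "nonunital_ring R \<and> weakly_s_unital R"
  then show "SCu_object (Lambda R, Smon R)"
    using ws_unital_ring.SCu_object by (simp add: ws_unital_ring_iff)
next
  fix R :: "'a ring" and R' :: "'b ring" and f
  assume "nonunital_ring R \<and> weakly_s_unital R \<and> nonunital_ring R' \<and> weakly_s_unital R'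
    \<and> f \<in> nonunital_hom R R'"
  then interpret ws_unital_ring_hom R R' f
    by (simp add: ws_unital_ring_hom_def ws_unital_ring_hom_axioms_def ws_unital_ring_iff)
  show "Lambda_map R R' f \<in> SCu_morphisms (Lambda R, Smon R) (Lambda R', Smon R')"
    by (rule Lambda_map_SCu_morphism)
  show "\<forall>x\<in>Tseqs R. map_mseq f x \<in> Tseqs R' \<and>
      Lambda_map R R' f (Lambda_class R x) = Lambda_class R' (map_mseq f x)"
    using map_mseq_Tseqs Lambda_map_class by blast
qed

end
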